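(* Let $A:\hat\Sigma\to\mathbb{R}$ be a $\theta$-Hölder observable. Then there exists a $\theta$-Hölder separating sub-action for $A$. Moreover, in the $\theta$-Hölder topology, the subset of $\theta$-Hölder separating sub-actions is generic among all $\theta$-Hölder sub-actions; that is, within the set of all $\theta$-Hölder sub-actions for $A$ endowed with the topology induced by the $\theta$-Hölder norm, the set of separating ones contains a countable intersection of open dense subsets.
   Context: Subshift. Let $\mathbf{M}$ be an irreducible $s\times s$ transition matrix with entries in $\{0,1\}$, let $\Sigma=\{\mathbf{x}=(x_0,x_1,\ldots)\in\{1,\ldots,s\}^{\mathbb{N}} : \mathbf{M}(x_j,x_{j+1})=1\ \forall j\ge 0\}$ be the associated one-sided transitive subshift of finite type, and let $\sigma(x_0,x_1,\ldots)=(x_1,x_2,\ldots)$. Fix $\lambda\in(0,1)$; $\Sigma$ carries the metric $d(\mathbf{x},\bar{\mathbf{x}})=\lambda^{k}$, $k=\min\{j:x_j\neq\bar x_j\}$ (and $d(\mathbf{x},\mathbf{x})=0$). Let $\Sigma^*=\{\mathbf{y}=(\ldots,y_2,y_1)\in\{1,\ldots,s\}^{\{1,2,\ldots\}} : \mathbf{M}(y_{j+1},y_j)=1\ \forall j\ge1\}$ with the analogous metric. Put $\Sigma^*_{\mathbf{x}}=\{\mathbf{y}\in\Sigma^*:\mathbf{M}(y_1,x_0)=1\}$ and $\hat\Sigma=\{(\mathbf{y},\mathbf{x})\in\Sigma^*\times\Sigma:\mathbf{y}\in\Sigma^*_{\mathbf{x}}\}$, with the maximum metric; $\pi:\hat\Sigma\to\Sigma$,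 $\pi(\mathbf{y},\mathbf{x})=\mathbf{x}$. For $(\mathbf{y},\mathbf{x})\in\hat\Sigma$ put $\tau_{\mathbf{y}}(\mathbf{x})=(y_1,x_0,x_1,\ldots)\in\Sigma$. Holonomic minimizing value. $\hat{\mathcal{M}}_{\rm hol}$ is the set of Borel probability measures $\hat\mu$ on $\hat\Sigma$ with $\int f(\tau_{\mathbf{y}}(\mathbf{x}))\,d\hat\mu(\mathbf{y},\mathbf{x})=\int f(\mathbf{x})\,d\hat\mu(\mathbf{y},\mathbf{x})$ for all $f\in C^0(\Sigma)$. For an observable $A:\hat\Sigma\to\mathbb{R}$, $\bar A=\min\{\int A\,d\hat\mu:\hat\mu\in\hat{\mathcal{M}}_{\rm hol}\}$. Sub-actions. A sub-action for $A$ is a continuous $u:\Sigma\to\mathbb{R}$ with $u(\mathbf{x})-u(\tau_{\mathbf{y}}(\mathbf{x}))\le A(\mathbf{y},\mathbf{x})-\bar A$ for all $(\mathbf{y},\mathbf{x})\in\hat\Sigma$. Its contact locus $\hat{\mathbb{M}}_A(u)\subset\hat\Sigma$ is the set of $(\mathbf{y},\mathbf{x})$ where equality holds. Non-wandering set. A path of length $k$ is a sequence $(\mathbf{z}^0,\ldots,\mathbf{z}^k)$ in $\hat\Sigma$, $\mathbf{z}^i=(\mathbf{y}^i,\mathbf{x}^i)$, with $\mathbf{x}^i=\tau_{\mathbf{y}^{i+1}}(\mathbf{x}^{i+1})$ for $0\le i\le k-1$. $\mathcal{P}_k(\mathbf{x},\bar{\mathbf{x}},\epsilon)$ is the set of paths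 of length $k$ with $d(\mathbf{x}^0,\mathbf{x})<\epsilon$ and $d(\mathbf{x}^k,\bar{\mathbf{x}})<\epsilon$. $\Omega(A)$ is the set of $\mathbf{x}\in\Sigma$ such that for every $\epsilon>0$ there are $k\ge1$ and $(\mathbf{z}^0,\ldots,\mathbf{z}^k)\in\mathcal{P}_k(\mathbf{x},\mathbf{x},\epsilon)$ with $\big|\sum_{i=1}^k(A-\bar A)(\mathbf{z}^i)\big|<\epsilon$. A sub-action $u$ is separating (with respect to $A$) if $\pi(\hat{\mathbb{M}}_A(u))=\Omega(A)$. The $\theta$-Hölder topology ($0<\theta\le1$) on $\theta$-Hölder functions $u:\Sigma\to\mathbb{R}$ is given by the norm $\|u\|_\infty+\sup_{\mathbf{x}\ne\bar{\mathbf{x}}}|u(\mathbf{x})-u(\bar{\mathbf{x}})|/d(\mathbf{x},\bar{\mathbf{x}})^\theta$. *)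

theory Defs
  imports "HOL-Analysis.Analysis" "HOL-Probability.Probability"
begin

section \<open>The subshift and its natural extension\<close>

text \<open>The alphabet is an arbitrary finite (nonempty) type.\<close>

definition transition_matrix :: "nat ^ 's ^ 's::finite \<Rightarrow> bool" where
  "transition_matrix T \<longleftrightarrow> (\<forall>i j. T $ i $ j \<in> {0, 1})"

definition matrix_pow :: "nat ^ 's ^ 's::finite \<Rightarrow> nat \<Rightarrow> nat ^ 's ^ 's" where
  "matrix_pow T n = (((**) T) ^^ n) (mat 1)"

definition irreducible_matrix :: "nat ^ 's ^ 's::finite \<Rightarrow> bool" where
  "irreducible_matrix T \<longleftrightarrow> (\<forall>i j. \<exists>n\<ge>1. matrix_pow T n $ i $ j > 0)"

definition shift_space :: "nat ^ 's ^ 's::finite \<Rightarrow> (nat \<Rightarrow> 's) set" where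
  "shift_space T = {x. \<forall>j. T $ x j $ x (Suc j) = 1}"

definition shift_dist :: "real \<Rightarrow> (nat \<Rightarrow> 's) \<Rightarrow> (nat \<Rightarrow> 's) \<Rightarrow> real" where
  "shift_dist lam x x' = (if x = x' then 0 else lam ^ (LEAST j. x j \<noteq> x' j))"

text \<open>
  A past \<open>(\<dots>, y\<^sub>2, y\<^sub>1)\<close> is encoded as the function \<open>y\<close> with \<open>y j = y\<^sub>j\<^sub>+\<^sub>1\<close>, so that
  \<open>y 0\<close> is the symbol \<open>y\<^sub>1\<close> next to the origin; this offset is the reason
  for the \<open>Suc\<close> in \<open>past_dist\<close>.
\<close>

definition past_space :: "nat ^ 's ^ 's::finite \<Rightarrow> (nat \<Rightarrow> 's) set" where
  "past_space T = {y. \<forall>j. T $ y (Suc j) $ y j = 1}"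

definition past_dist :: "real \<Rightarrow> (nat \<Rightarrow> 's) \<Rightarrow> (nat \<Rightarrow> 's) \<Rightarrow> real" where
  "past_dist lam y y' = (if y = y' then 0 else lam ^ Suc (LEAST j. y j \<noteq> y' j))"

definition past_fibre :: "nat ^ 's ^ 's::finite \<Rightarrow> (nat \<Rightarrow> 's) \<Rightarrow> (nat \<Rightarrow> 's) set" where
  "past_fibre T x = {y \<in> past_space T. T $ y 0 $ x 0 = 1}"

type_synonym 's bisequence = "(nat \<Rightarrow> 's) \<times> (nat \<Rightarrow> 's)"

definition ext_space :: "nat ^ 's ^ 's::finite \<Rightarrow> 's bisequence set" where
  "ext_space T = {(y, x). x \<in> shift_space T \<and> y \<in> past_fibre T x}"

definition ext_dist :: "real \<Rightarrow> 's bisequence \<Rightarrow> 's bisequence \<Rightarrow> real" where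
  "ext_dist lam z z' = max (past_dist lam (fst z) (fst z')) (shift_dist lam (snd z) (snd z'))"

definition prepend :: "(nat \<Rightarrow> 's) \<Rightarrow> (nat \<Rightarrow> 's) \<Rightarrow> (nat \<Rightarrow> 's)" where
  "prepend y x = case_nat (y 0) x"

abbreviation shift_top :: "nat ^ 's ^ 's::finite \<Rightarrow> real \<Rightarrow> (nat \<Rightarrow> 's) topology" where
  "shift_top T lam \<equiv> Metric_space.mtopology (shift_space T) (shift_dist lam)"

abbreviation ext_top :: "nat ^ 's ^ 's::finite \<Rightarrow> real \<Rightarrow> 's bisequence topology" where
  "ext_top T lam \<equiv> Metric_space.mtopology (ext_space T) (ext_dist lam)"

lemma shift_dist_ultra:
  assumes "0 < lam" "lam < 1"
  shows "shift_dist lam x z \<le> max (shift_dist lam x y) (shift_dist lam y z)"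
proof (cases "x = y \<or> y = z \<or> x = z")
  case True
  have "0 \<le> shift_dist lam a b" for a b :: "nat \<Rightarrow> 'a"
    using assms by (simp add: shift_dist_def)
  moreover have "shift_dist lam x x = 0" by (simp add: shift_dist_def)
  ultimately show ?thesis using True by (auto simp: le_max_iff_disj)
next
  case False
  define k where "k = (LEAST j. x j \<noteq> z j)"
  have "x k \<noteq> z k"
    using LeastI_ex[of "\<lambda>j. x j \<noteq> z j"] False unfolding k_def by (simp add: fun_eq_iff)
  then consider "x k \<noteq> y k" | "y k \<noteq> z k" by metis
  then show ?thesis
  proof cases
    case 1
    then have "(LEAST j. x j \<noteq> y j) \<le> k" by (rule Least_le[of "\<lambda>j. x j \<noteq> y j"])
    then have "lam ^ k \<le> lam ^ (LEAST j. x j \<noteq> y j)"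
      using assms by (intro power_decreasing) auto
    then show ?thesis using False by (simp add: shift_dist_def k_def le_max_iff_disj)
  next
    case 2
    then have "(LEAST j. y j \<noteq> z j) \<le> k" by (rule Least_le[of "\<lambda>j. y j \<noteq> z j"])
    then have "lam ^ k \<le> lam ^ (LEAST j. y j \<noteq> z j)"
      using assms by (intro power_decreasing) auto
    then show ?thesis using False by (simp add: shift_dist_def k_def le_max_iff_disj)
  qed
qed

lemma shift_dist_nonneg: "0 < lam \<Longrightarrow> 0 \<le> shift_dist lam x y"
  by (simp add: shift_dist_def)

lemma shift_dist_commute: "shift_dist lam x y = shift_dist lam y x"
proof -
  have "(\<lambda>j. x j \<noteq> y j) = (\<lambda>j. y j \<noteq> x j)" by auto
  then show ?thesis unfolding shift_dist_def by metis
qed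

lemma shift_dist_eq_0: "0 < lam \<Longrightarrow> shift_dist lam x y = 0 \<longleftrightarrow> x = y"
  by (simp add: shift_dist_def)

lemma past_dist_eq: "past_dist lam x y = lam * shift_dist lam x y"
  by (simp add: past_dist_def shift_dist_def)

lemma shift_dist_triangle:
  assumes "0 < lam" "lam < 1"
  shows "shift_dist lam x z \<le> shift_dist lam x y + shift_dist lam y z"
  using shift_dist_ultra[OF assms, of x z y] shift_dist_nonneg[OF assms(1), of x y]
    shift_dist_nonneg[OF assms(1), of y z] by linarith

lemma Metric_space_shift:
  assumes "0 < lam" "lam < 1"
  shows "Metric_space X (shift_dist lam)"
proof
  fix x y z :: "nat \<Rightarrow> 'a"
  show "0 \<le> shift_dist lam x y" using assms(1) by (rule shift_dist_nonneg)
  show "shift_dist lam x y = shift_dist lam y x" by (rule shift_dist_commute)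
  show "(shift_dist lam x y = 0) = (x = y)" using assms(1) by (rule shift_dist_eq_0)
  show "shift_dist lam x z \<le> shift_dist lam x y + shift_dist lam y z"
    using assms by (rule shift_dist_triangle)
qed

lemma Metric_space_ext:
  assumes "0 < lam" "lam < 1"
  shows "Metric_space X (ext_dist lam)"
proof
  fix a b c :: "'a bisequence"
  show "0 \<le> ext_dist lam a b"
    using assms by (simp add: ext_dist_def shift_dist_nonneg le_max_iff_disj)
  show "ext_dist lam a b = ext_dist lam b a"
    using shift_dist_commute[of lam "fst a" "fst b"] shift_dist_commute[of lam "snd a" "snd b"]
    by (simp add: ext_dist_def past_dist_eq)
  have "0 \<le> past_dist lam (fst a) (fst b)"
    using assms by (simp add: past_dist_eq shift_dist_nonneg)
  moreover have "0 \<le> shift_dist lam (snd a) (snd b)"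
    using assms by (simp add: shift_dist_nonneg)
  ultimately show "(ext_dist lam a b = 0) = (a = b)"
    using shift_dist_eq_0[OF assms(1), of "fst a" "fst b"]
      shift_dist_eq_0[OF assms(1), of "snd a" "snd b"] assms(1)
    unfolding ext_dist_def past_dist_eq prod_eq_iff
    by (smt (verit) mult_eq_0_iff)
  have "past_dist lam (fst a) (fst c) \<le> past_dist lam (fst a) (fst b) + past_dist lam (fst b) (fst c)"
    using mult_left_mono[OF shift_dist_triangle[OF assms], of lam "fst a" "fst c" "fst b"] assms
    by (simp add: past_dist_eq distrib_left)
  then show "ext_dist lam a c \<le> ext_dist lam a b + ext_dist lam b c"
    using shift_dist_triangle[OF assms, of "snd a" "snd c" "snd b"]
    by (auto simp: ext_dist_def)
qed

section \<open>Holonomic measures and the minimizing value\<close>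

definition borel_on :: "'a topology \<Rightarrow> 'a measure" where
  "borel_on X = sigma (topspace X) {U. openin X U}"

definition holonomic_measures ::
    "nat ^ 's ^ 's::finite \<Rightarrow> real \<Rightarrow> 's bisequence measure set" where
  "holonomic_measures T lam = {\<mu>. prob_space \<mu> \<and> sets \<mu> = sets (borel_on (ext_top T lam)) \<and>
     (\<forall>f. continuous_map (shift_top T lam) euclideanreal f \<longrightarrow>
        (\<integral>z. f (prepend (fst z) (snd z)) \<partial>\<mu>) = (\<integral>z. f (snd z) \<partial>\<mu>))}"

text \<open>\<open>LEAST\<close> is the minimum of the set of integrals, not merely its infimum.\<close>

definition min_value ::
    "nat ^ 's ^ 's::finite \<Rightarrow> real \<Rightarrow> ('s bisequence \<Rightarrow> real) \<Rightarrow> real" where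
  "min_value T lam A = (LEAST a. \<exists>\<mu>\<in>holonomic_measures T lam. a = (\<integral>z. A z \<partial>\<mu>))"

section \<open>Sub-actions\<close>

definition subaction ::
    "nat ^ 's ^ 's::finite \<Rightarrow> real \<Rightarrow> ('s bisequence \<Rightarrow> real) \<Rightarrow> ((nat \<Rightarrow> 's) \<Rightarrow> real) \<Rightarrow> bool" where
  "subaction T lam A u \<longleftrightarrow> continuous_map (shift_top T lam) euclideanreal u \<and>
     (\<forall>(y, x)\<in>ext_space T. u x - u (prepend y x) \<le> A (y, x) - min_value T lam A)"

definition contact_locus ::
    "nat ^ 's ^ 's::finite \<Rightarrow> real \<Rightarrow> ('s bisequence \<Rightarrow> real) \<Rightarrow> ((nat \<Rightarrow> 's) \<Rightarrow> real) \<Rightarrow>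
     's bisequence set" where
  "contact_locus T lam A u =
     {(y, x) \<in> ext_space T. u x - u (prepend y x) = A (y, x) - min_value T lam A}"

text \<open>
  A path \<open>(z 0, \<dots>, z k)\<close> is given by a function on the naturals; its values beyond \<open>k\<close>
  are irrelevant.
\<close>

definition paths ::
    "nat ^ 's ^ 's::finite \<Rightarrow> real \<Rightarrow> nat \<Rightarrow> (nat \<Rightarrow> 's) \<Rightarrow> (nat \<Rightarrow> 's) \<Rightarrow> real \<Rightarrow>
     (nat \<Rightarrow> 's bisequence) set" where
  "paths T lam k x x' \<epsilon> = {z. (\<forall>i\<le>k. z i \<in> ext_space T) \<and>
     (\<forall>i<k. snd (z i) = prepend (fst (z (Suc i))) (snd (z (Suc i)))) \<and>
     shift_dist lam (snd (z 0)) x < \<epsilon> \<and> shift_dist lam (snd (z k)) x' < \<epsilon>}"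

definition nonwandering ::
    "nat ^ 's ^ 's::finite \<Rightarrow> real \<Rightarrow> ('s bisequence \<Rightarrow> real) \<Rightarrow> (nat \<Rightarrow> 's) set" where
  "nonwandering T lam A = {x \<in> shift_space T. \<forall>\<epsilon>>0. \<exists>k\<ge>1. \<exists>z\<in>paths T lam k x x \<epsilon>.
     \<bar>\<Sum>i=1..k. A (z i) - min_value T lam A\<bar> < \<epsilon>}"

definition separating ::
    "nat ^ 's ^ 's::finite \<Rightarrow> real \<Rightarrow> ('s bisequence \<Rightarrow> real) \<Rightarrow> ((nat \<Rightarrow> 's) \<Rightarrow> real) \<Rightarrow> bool" where
  "separating T lam A u \<longleftrightarrow>
     subaction T lam A u \<and> snd ` contact_locus T lam A u = nonwandering T lam A"

section \<open>Hoelder functions\<close>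

definition holder_on :: "'a set \<Rightarrow> ('a \<Rightarrow> 'a \<Rightarrow> real) \<Rightarrow> real \<Rightarrow> ('a \<Rightarrow> real) \<Rightarrow> bool" where
  "holder_on X d \<theta> f \<longleftrightarrow> (\<exists>C. \<forall>x\<in>X. \<forall>x'\<in>X. \<bar>f x - f x'\<bar> \<le> C * d x x' powr \<theta>)"

text \<open>
  The functions are taken extensional, so that each function on the subshift has exactly one
  representative and the norm below separates points.
\<close>

definition holder_functions ::
    "nat ^ 's ^ 's::finite \<Rightarrow> real \<Rightarrow> real \<Rightarrow> ((nat \<Rightarrow> 's) \<Rightarrow> real) set" where
  "holder_functions T lam \<theta> =
     {u \<in> extensional (shift_space T). holder_on (shift_space T) (shift_dist lam) \<theta> u}"

text \<open>
  The element \<open>0\<close> is inserted for the case that the subshift is a single point: the set of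
  Hoelder quotients is then empty, and \<open>Sup {}\<close> is unspecified on the reals.
\<close>

definition holder_norm ::
    "nat ^ 's ^ 's::finite \<Rightarrow> real \<Rightarrow> real \<Rightarrow> ((nat \<Rightarrow> 's) \<Rightarrow> real) \<Rightarrow> real" where
  "holder_norm T lam \<theta> u = (SUP x\<in>shift_space T. \<bar>u x\<bar>) +
     Sup (insert 0 {\<bar>u x - u x'\<bar> / shift_dist lam x x' powr \<theta> | x x'.
       x \<in> shift_space T \<and> x' \<in> shift_space T \<and> x \<noteq> x'})"

text \<open>
  The guard is only needed because the axioms of \<open>Metric_space\<close> demand nonnegativity outside
  the carrier as well.
\<close>

definition holder_dist ::
    "nat ^ 's ^ 's::finite \<Rightarrow> real \<Rightarrow> real \<Rightarrow> ((nat \<Rightarrow> 's) \<Rightarrow> real) \<Rightarrow> ((nat \<Rightarrow> 's) \<Rightarrow> real) \<Rightarrow> real" where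
  "holder_dist T lam \<theta> u v =
     (if u \<in> holder_functions T lam \<theta> \<and> v \<in> holder_functions T lam \<theta>
      then holder_norm T lam \<theta> (\<lambda>x. u x - v x) else 0)"

definition holder_top ::
    "nat ^ 's ^ 's::finite \<Rightarrow> real \<Rightarrow> real \<Rightarrow> ((nat \<Rightarrow> 's) \<Rightarrow> real) topology" where
  "holder_top T lam \<theta> = Metric_space.mtopology (holder_functions T lam \<theta>) (holder_dist T lam \<theta>)"

lemma holder_norm_bdd:
  assumes "0 < lam" "lam < 1" "0 < \<theta>" and "holder_on (shift_space T) (shift_dist lam) \<theta> u"
  shows "bdd_above ((\<lambda>x. \<bar>u x\<bar>) ` shift_space T)"
    and "bdd_above (insert 0 {\<bar>u x - u x'\<bar> / shift_dist lam x x' powr \<theta> | x x'.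
       x \<in> shift_space T \<and> x' \<in> shift_space T \<and> x \<noteq> x'})"
proof -
  obtain C where C: "\<And>x x'. x \<in> shift_space T \<Longrightarrow> x' \<in> shift_space T \<Longrightarrow>
      \<bar>u x - u x'\<bar> \<le> C * shift_dist lam x x' powr \<theta>"
    using assms(4) by (auto simp: holder_on_def)
  have le1: "shift_dist lam x x' \<le> 1" for x x' :: "nat \<Rightarrow> 'a"
    using assms by (auto simp: shift_dist_def intro!: power_le_one)
  have p1: "shift_dist lam x x' powr \<theta> \<le> 1" for x x' :: "nat \<Rightarrow> 'a"
    using assms le1[of x x'] shift_dist_nonneg[of lam x x'] by (simp add: powr_le1)
  show "bdd_above ((\<lambda>x. \<bar>u x\<bar>) ` shift_space T)"
  proof (cases "shift_space T = {}")
    case False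
    then obtain x0 where x0: "x0 \<in> shift_space T" by auto
    have "\<bar>u x\<bar> \<le> \<bar>u x0\<bar> + \<bar>C\<bar>" if "x \<in> shift_space T" for x
    proof -
      have "C * shift_dist lam x x0 powr \<theta> \<le> \<bar>C\<bar> * 1"
        using p1[of x x0] by (intro mult_mono) auto
      then show ?thesis using C[OF that x0] by linarith
    qed
    then show ?thesis by (intro bdd_aboveI2[where M = "\<bar>u x0\<bar> + \<bar>C\<bar>"])
  qed simp
  have "\<bar>u x - u x'\<bar> / shift_dist lam x x' powr \<theta> \<le> \<bar>C\<bar>"
    if "x \<in> shift_space T" "x' \<in> shift_space T" "x \<noteq> x'" for x x'
  proof -
    have "shift_dist lam x x' powr \<theta> > 0"
      using that assms shift_dist_eq_0[of lam x x'] by simp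
    then have "\<bar>u x - u x'\<bar> / shift_dist lam x x' powr \<theta> \<le> C"
      using C[OF that(1,2)] by (simp add: pos_divide_le_eq)
    then show ?thesis by linarith
  qed
  then show "bdd_above (insert 0 {\<bar>u x - u x'\<bar> / shift_dist lam x x' powr \<theta> | x x'.
       x \<in> shift_space T \<and> x' \<in> shift_space T \<and> x \<noteq> x'})"
    by (intro bdd_aboveI[where M = "\<bar>C\<bar>"]) auto
qed

lemma holder_on_diff:
  assumes "holder_on X d \<theta> u" "holder_on X d \<theta> v"
  shows "holder_on X d \<theta> (\<lambda>x. u x - v x)"
proof -
  obtain C D where
    C: "\<And>x x'. x \<in> X \<Longrightarrow> x' \<in> X \<Longrightarrow> \<bar>u x - u x'\<bar> \<le> C * d x x' powr \<theta>" and
    D: "\<And>x x'. x \<in> X \<Longrightarrow> x' \<in> X \<Longrightarrow> \<bar>v x - v x'\<bar> \<le> D * d x x' powr \<theta>"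
    using assms unfolding holder_on_def by metis
  have "\<bar>(u x - v x) - (u x' - v x')\<bar> \<le> (C + D) * d x x' powr \<theta>" if "x \<in> X" "x' \<in> X" for x x'
    using C[OF that] D[OF that] by (simp add: distrib_right)
  then show ?thesis unfolding holder_on_def by blast
qed

lemma Metric_space_holder:
  assumes lam: "0 < lam" "lam < 1" "0 < \<theta>" and ne: "shift_space T \<noteq> {}"
  shows "Metric_space (holder_functions T lam \<theta>) (holder_dist T lam \<theta>)"
proof -
  let ?S = "\<lambda>u. SUP x\<in>shift_space T. \<bar>u x\<bar>"
  let ?Q = "\<lambda>u. insert 0 {\<bar>u x - u x'\<bar> / shift_dist lam x x' powr \<theta> | x x'.
       x \<in> shift_space T \<and> x' \<in> shift_space T \<and> x \<noteq> x'}"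
  let ?H = "holder_on (shift_space T) (shift_dist lam) \<theta>"
  have Q0: "0 \<le> Sup (?Q u)" if "?H u" for u
    by (rule cSup_upper[OF _ holder_norm_bdd(2)[OF lam that]]) auto
  have S: "\<bar>u x\<bar> \<le> ?S u" if "?H u" "x \<in> shift_space T" for u x
    by (rule cSUP_upper[OF that(2) holder_norm_bdd(1)[OF lam that(1)]])
  have S0: "0 \<le> ?S u" if "?H u" for u
    using ne S[OF that] by (meson abs_ge_zero ex_in_conv order_trans)
  have nn: "0 \<le> holder_norm T lam \<theta> u" if "?H u" for u
    using Q0[OF that] S0[OF that] by (simp add: holder_norm_def)
  have sub: "holder_norm T lam \<theta> (\<lambda>x. u x + v x) \<le> holder_norm T lam \<theta> u + holder_norm T lam \<theta> v"
    if u: "?H u" and v: "?H v" for u v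
  proof -
    have "?S (\<lambda>x. u x + v x) \<le> ?S u + ?S v"
    proof (rule cSUP_least[OF ne])
      fix x assume x: "x \<in> shift_space T"
      show "\<bar>u x + v x\<bar> \<le> ?S u + ?S v" using S[OF u x] S[OF v x] by linarith
    qed
    moreover have "Sup (?Q (\<lambda>x. u x + v x)) \<le> Sup (?Q u) + Sup (?Q v)"
    proof (rule cSup_least)
      fix q assume "q \<in> ?Q (\<lambda>x. u x + v x)"
      then consider "q = 0" | x x' where "x \<in> shift_space T" "x' \<in> shift_space T" "x \<noteq> x'"
        "q = \<bar>(u x + v x) - (u x' + v x')\<bar> / shift_dist lam x x' powr \<theta>" by blast
      then show "q \<le> Sup (?Q u) + Sup (?Q v)"
      proof cases
        case 1
        then show ?thesis using Q0[OF u] Q0[OF v] by simp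
      next
        case 2
        have "q \<le> (\<bar>u x - u x'\<bar> + \<bar>v x - v x'\<bar>) / shift_dist lam x x' powr \<theta>"
          unfolding 2(4) by (intro divide_right_mono) auto
        also have "\<dots> = \<bar>u x - u x'\<bar> / shift_dist lam x x' powr \<theta> +
            \<bar>v x - v x'\<bar> / shift_dist lam x x' powr \<theta>"
          by (simp add: add_divide_distrib)
        also have "\<dots> \<le> Sup (?Q u) + Sup (?Q v)"
          using 2 by (intro add_mono cSup_upper holder_norm_bdd(2)[OF lam u]
              holder_norm_bdd(2)[OF lam v]) auto
        finally show ?thesis .
      qed
    qed auto
    ultimately show ?thesis by (simp add: holder_norm_def)
  qed
  have H: "?H (\<lambda>x. u x - v x)" if "u \<in> holder_functions T lam \<theta>" "v \<in> holder_functions T lam \<theta>" for u v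
    using that by (auto simp: holder_functions_def intro: holder_on_diff)
  show ?thesis
  proof
    fix u v w
    show "0 \<le> holder_dist T lam \<theta> u v"
      using nn[OF H] by (simp add: holder_dist_def)
    show "holder_dist T lam \<theta> u v = holder_dist T lam \<theta> v u"
    proof -
      have neg: "holder_norm T lam \<theta> (\<lambda>x. - f x) = holder_norm T lam \<theta> f" for f
      proof -
        have "\<bar>- f x - - f x'\<bar> = \<bar>f x - f x'\<bar>" for x x' by linarith
        then show ?thesis unfolding holder_norm_def by (simp only: abs_minus_cancel)
      qed
      have "holder_norm T lam \<theta> (\<lambda>x. u x - v x) = holder_norm T lam \<theta> (\<lambda>x. v x - u x)"
        using neg[of "\<lambda>x. v x - u x"] by (simp only: minus_diff_eq)
      then show ?thesis unfolding holder_dist_def by meson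
    qed
    assume u: "u \<in> holder_functions T lam \<theta>" and v: "v \<in> holder_functions T lam \<theta>"
    show "(holder_dist T lam \<theta> u v = 0) = (u = v)"
    proof
      assume "holder_dist T lam \<theta> u v = 0"
      then have "?S (\<lambda>x. u x - v x) \<le> 0"
        using u v Q0[OF H[OF u v]] by (simp add: holder_dist_def holder_norm_def)
      then have "u x = v x" if "x \<in> shift_space T" for x
        using S[OF H[OF u v] that] by linarith
      then show "u = v"
        using u v by (auto simp: holder_functions_def intro: extensionalityI)
    next
      assume "u = v"
      have "?Q (\<lambda>x. v x - v x) = {0}" by auto
      then have "Sup (?Q (\<lambda>x. v x - v x)) = 0" by (simp only: cSup_singleton)
      moreover have "?S (\<lambda>x. v x - v x) = 0" using ne by simp
      ultimately have "holder_norm T lam \<theta> (\<lambda>x. v x - v x) = 0"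
        unfolding holder_norm_def by (simp only: add_0)
      with \<open>u = v\<close> show "holder_dist T lam \<theta> u v = 0"
        by (simp only: holder_dist_def if_cancel)
    qed
    assume w: "w \<in> holder_functions T lam \<theta>"
    show "holder_dist T lam \<theta> u w \<le> holder_dist T lam \<theta> u v + holder_dist T lam \<theta> v w"
      using sub[OF H[OF u v] H[OF v w]] u v w by (simp add: holder_dist_def)
  qed
qed

definition holder_subactions ::
    "nat ^ 's ^ 's::finite \<Rightarrow> real \<Rightarrow> real \<Rightarrow> ('s bisequence \<Rightarrow> real) \<Rightarrow>
     ((nat \<Rightarrow> 's) \<Rightarrow> real) set" where
  "holder_subactions T lam \<theta> A = {u \<in> holder_functions T lam \<theta>. subaction T lam A u}"

definition generic_in :: "'a topology \<Rightarrow> 'a set \<Rightarrow> bool" where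
  "generic_in X S \<longleftrightarrow> (\<exists>U::nat \<Rightarrow> 'a set.
     (\<forall>n. openin X (U n) \<and> X closure_of U n = topspace X) \<and> (\<Inter>n. U n) \<subseteq> S)"

end

theory Submission
  imports Defs
begin

text \<open>
  Minimizing the observable over the part of the past that the dynamics does not see turns it into a
  Hoelder potential \<open>\<phi>\<close> on the one-sided shift, and sub-actions become solutions of
  \<open>u \<circ> \<sigma> \<le> u + \<phi> - c\<close>. The infima of the Birkhoff sums of \<open>\<phi>\<close> are \<open>n c + O(1)\<close>, so the
  infimal cost of reaching a point is a Hoelder solution; integrating it, and taking weak limits of
  empirical measures along almost optimal orbits, identifies \<open>c\<close> with the holonomic minimum.

  Every contact locus projects onto a superset of the non-wandering set, by compactness. Conversely, around
  a point outside that set there is a cylinder to which no orbit returns at almost zero cost. Adding a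
  small penalty outside the cylinder to a given solution and passing to the largest solution below the
  result yields a solution with strict inequality over the cylinder. As there are countably many cylinders,
  a convex series of these is separating. Strictness over a fixed cylinder, uniformly there, is an open
  condition, and it is dense because it survives convex combination with any sub-action.
\<close>

section \<open>Words and orbits\<close>

text \<open>Since \<open>prepend\<close> uses only the first letter of the past, a pair
  \<open>(y, x)\<close> is read as the point \<open>w = prepend y x\<close> with a choice of the
  remaining past; then \<open>x\<close> is \<open>shift_by 1 w\<close>, and a path is an orbit
  segment of the shift read forward. Infima over the remaining past are approximated, with errors
  that vanish in the limit. Separation is a circle of inclusions: contact points of the constructed
  solution project into the non-wandering set of the potential, this set lies in the one of
  \<open>A\<close>, and that one lies in the projection of every contact locus of a Hoelder
  sub-action. The obstacle is uniformity. Countably many penalized solutions must be summed without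
  leaving the Hoelder class, so their Hoelder constants may not depend on the cylinder. Hence the
  penalty for a cylinder of length \<open>n\<close> has height \<open>q ^ n\<close> with
  \<open>q = lam powr \<theta>\<close>, which keeps its Hoelder constant at most 1; the height
  shrinks with \<open>n\<close>, but any positive gap will do. Passing to the largest solution keeps
  the bound uniform, because points with the same first letter have the same histories, and Birkhoff
  sums along these differ by a geometric series.\<close>

definition shift_by :: "nat \<Rightarrow> (nat \<Rightarrow> 's) \<Rightarrow> (nat \<Rightarrow> 's)" where
  "shift_by k w = (\<lambda>j. w (k + j))"

definition splice :: "nat \<Rightarrow> (nat \<Rightarrow> 's) \<Rightarrow> (nat \<Rightarrow> 's) \<Rightarrow> (nat \<Rightarrow> 's)" where
  "splice k w x = (\<lambda>j. if j < k then w j else x (j - k))"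

lemma shift_by_0 [simp]: "shift_by 0 w = w"
  by (simp add: shift_by_def)

lemma shift_by_apply: "shift_by k w j = w (k + j)"
  by (simp add: shift_by_def)

lemma shift_by_shift_by [simp]: "shift_by a (shift_by b w) = shift_by (b + a) w"
  by (simp add: shift_by_def add.assoc)

lemma shift_by_splice [simp]: "shift_by k (splice k w x) = x"
  by (simp add: shift_by_def splice_def)

lemma splice_less [simp]: "j < k \<Longrightarrow> splice k w x j = w j"
  by (simp add: splice_def)

lemma shift_by_in_space: "w \<in> shift_space T \<Longrightarrow> shift_by k w \<in> shift_space T"
  by (simp add: shift_space_def shift_by_apply)

lemma splice_in_space:
  assumes "\<And>j. Suc j < k \<Longrightarrow> T $ w j $ w (Suc j) = 1" and "x \<in> shift_space T"
    and "k > 0 \<Longrightarrow> T $ w (k - 1) $ x 0 = 1"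
  shows "splice k w x \<in> shift_space T"
proof -
  have "T $ splice k w x j $ splice k w x (Suc j) = 1" for j
  proof -
    consider "Suc j < k" | "Suc j = k" | "k \<le> j" by linarith
    then show ?thesis
    proof cases
      case 3
      then have "Suc j - k = Suc (j - k)" by simp
      with 3 assms(2) show ?thesis by (simp add: splice_def shift_space_def)
    qed (use assms in \<open>auto simp: splice_def\<close>)
  qed
  then show ?thesis by (simp add: shift_space_def)
qed

text \<open>Closed balls of radius \<open>lam ^ n\<close> are cylinders; from here on metric
  statements are turned into agreement of finite words.\<close>

lemma shift_dist_le_iff:
  assumes "0 < lam" "lam < 1"
  shows "shift_dist lam x x' \<le> lam ^ n \<longleftrightarrow> (\<forall>j<n. x j = x' j)"
proof (cases "x = x'")
  case False
  define k where "k = (LEAST j. x j \<noteq> x' j)"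
  have k: "x k \<noteq> x' k"
    using LeastI_ex[of "\<lambda>j. x j \<noteq> x' j"] False unfolding k_def by (simp add: fun_eq_iff)
  have l: "x j = x' j" if "j < k" for j
    using not_less_Least[of j "\<lambda>j. x j \<noteq> x' j"] that unfolding k_def by blast
  have "lam ^ k \<le> lam ^ n \<longleftrightarrow> n \<le> k"
    using assms by (simp add: power_decreasing_iff)
  moreover have "n \<le> k \<longleftrightarrow> (\<forall>j<n. x j = x' j)"
    using k l by (meson leI order_less_le_trans)
  ultimately show ?thesis using False by (simp add: shift_dist_def k_def)
qed (use assms in \<open>simp add: shift_dist_def\<close>)

lemma shift_dist_le_1: "0 < lam \<Longrightarrow> lam < 1 \<Longrightarrow> shift_dist lam x x' \<le> 1"
  using shift_dist_le_iff[of lam x x' 0] by simp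

lemma shift_dist_neq_0: "x 0 \<noteq> x' 0 \<Longrightarrow> shift_dist lam x x' = 1"
proof -
  assume "x 0 \<noteq> x' 0"
  then have "(LEAST j. x j \<noteq> x' j) = 0" by (simp add: Least_eq_0)
  then show ?thesis using \<open>x 0 \<noteq> x' 0\<close> by (auto simp: shift_dist_def)
qed

lemma shift_dist_ge:
  assumes "0 < lam" "lam < 1" "x j \<noteq> x' j"
  shows "lam ^ j \<le> shift_dist lam x x'"
proof -
  have "(LEAST j. x j \<noteq> x' j) \<le> j" using assms by (intro Least_le)
  then have "lam ^ j \<le> lam ^ (LEAST j. x j \<noteq> x' j)"
    using assms by (intro power_decreasing) auto
  then show ?thesis using assms by (auto simp: shift_dist_def)
qed

lemma shift_dist_shift:
  assumes "\<And>j. j < k \<Longrightarrow> w j = w' j"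
  shows "shift_dist lam w w' = lam ^ k * shift_dist lam (shift_by k w) (shift_by k w')"
proof (cases "w = w'")
  case False
  then obtain i where i: "w i \<noteq> w' i" by auto
  with assms have "k \<le> i" by (meson leI)
  with i have i': "w (k + (i - k)) \<noteq> w' (k + (i - k))" by simp
  then have ne: "shift_by k w \<noteq> shift_by k w'" by (metis shift_by_apply)
  have "(LEAST j. w j \<noteq> w' j) = k + (LEAST j. shift_by k w j \<noteq> shift_by k w' j)"
  proof (rule Least_equality)
    show "w (k + (LEAST j. shift_by k w j \<noteq> shift_by k w' j)) \<noteq>
        w' (k + (LEAST j. shift_by k w j \<noteq> shift_by k w' j))"
      using LeastI[of "\<lambda>j. shift_by k w j \<noteq> shift_by k w' j", OF i'[folded shift_by_apply]]
      by (simp add: shift_by_apply)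
    fix y assume y: "w y \<noteq> w' y"
    with assms have "k \<le> y" by (meson leI)
    with y have "shift_by k w (y - k) \<noteq> shift_by k w' (y - k)" by (simp add: shift_by_apply)
    then have "(LEAST j. shift_by k w j \<noteq> shift_by k w' j) \<le> y - k" by (rule Least_le)
    then show "k + (LEAST j. shift_by k w j \<noteq> shift_by k w' j) \<le> y" using \<open>k \<le> y\<close> by simp
  qed
  with False ne show ?thesis by (simp add: shift_dist_def power_add)
qed (simp add: shift_dist_def)

text \<open>An entry of the power is a sum of products of natural numbers, so positivity yields a
  nonzero summand; as the entries of \<open>T\<close> are 0 or 1, its first factor is an allowed
  transition.\<close>

lemma matrix_pow_path:
  assumes "transition_matrix T" "matrix_pow T n $ i $ j > 0"
  shows "\<exists>p. p 0 = i \<and> p n = j \<and> (\<forall>k<n. T $ p k $ p (Suc k) = 1)"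
  using assms(2)
proof (induction n arbitrary: i)
  case 0
  then have "i = j" by (auto simp: matrix_pow_def mat_def split: if_splits)
  then show ?case by auto
next
  case (Suc n)
  have "matrix_pow T (Suc n) $ i $ j = (\<Sum>k\<in>UNIV. T $ i $ k * matrix_pow T n $ k $ j)"
    by (simp add: matrix_pow_def matrix_matrix_mult_def)
  with Suc.prems obtain k where "T $ i $ k * matrix_pow T n $ k $ j \<noteq> 0"
    by (metis (no_types, lifting) less_numeral_extra(3) sum.neutral)
  then have k: "T $ i $ k \<noteq> 0" "matrix_pow T n $ k $ j > 0" by auto
  with assms(1) have k1: "T $ i $ k = 1" unfolding transition_matrix_def by (metis empty_iff insert_iff)
  from Suc.IH[OF k(2)] obtain p where
    p: "p 0 = k" "p n = j" "\<forall>k<n. T $ p k $ p (Suc k) = 1" by blast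
  show ?case
    by (rule exI[of _ "case_nat i p"])
      (use p k1 in \<open>auto split: nat.splits simp: less_Suc_eq_0_disj\<close>)
qed

section \<open>Irreducible subshifts: admissible words and gluing of orbits\<close>

locale irreducible_subshift =
  fixes T :: "nat ^ 's ^ 's::finite"
  assumes transition: "transition_matrix T" and irred: "irreducible_matrix T"
begin

abbreviation \<Sigma> :: "(nat \<Rightarrow> 's) set" where "\<Sigma> \<equiv> shift_space T"

lemma connecting_path:
  obtains n p where "n \<ge> 1" "p 0 = i" "p n = j" "\<And>k. k < n \<Longrightarrow> T $ p k $ p (Suc k) = 1"
  using irred matrix_pow_path[OF transition] unfolding irreducible_matrix_def by metis

lemma ex_successor: "\<exists>j. T $ i $ j = 1"
  using connecting_path[of i i] by (metis less_one order_less_le_trans One_nat_def Suc_le_eq)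

lemma ex_predecessor: "\<exists>i. T $ i $ j = 1"
proof -
  obtain n p where n: "n \<ge> 1" "p n = j" "\<And>k. k < n \<Longrightarrow> T $ p k $ p (Suc k) = 1"
    using connecting_path[of j j] by metis
  then have "T $ p (n - 1) $ p (Suc (n - 1)) = 1" by (intro n) simp
  with n show ?thesis by auto
qed

lemma ex_point: "\<exists>w\<in>\<Sigma>. w 0 = i"
proof -
  obtain f where f: "\<And>i. T $ i $ f i = 1" using ex_successor by metis
  have "(\<lambda>n. (f ^^ n) i) \<in> \<Sigma>" by (simp add: shift_space_def f)
  then show ?thesis by (intro bexI[of _ "\<lambda>n. (f ^^ n) i"]) auto
qed

lemma ex_past: "\<exists>y\<in>past_space T. y 0 = i"
proof -
  obtain f where f: "\<And>i. T $ f i $ i = 1" using ex_predecessor by metis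
  have "(\<lambda>n. (f ^^ n) i) \<in> past_space T" by (simp add: past_space_def f)
  then show ?thesis by (intro bexI[of _ "\<lambda>n. (f ^^ n) i"]) auto
qed

lemma space_nonempty: "\<Sigma> \<noteq> {}"
  using ex_point by blast

text \<open>There are finitely many pairs of letters, so connecting words have bounded length. That
  \<open>L\<close> is independent of \<open>n\<close> makes the infima of Birkhoff sums subadditive
  up to a constant.\<close>

lemma gluing:
  obtains L where "\<And>n w w'. w \<in> \<Sigma> \<Longrightarrow> w' \<in> \<Sigma> \<Longrightarrow>
    \<exists>v\<in>\<Sigma>. \<exists>l\<le>L. (\<forall>j<n. v j = w j) \<and> shift_by (n + l) v = w'"
proof -
  have "\<exists>n p. n \<ge> 1 \<and> p 0 = i \<and> p n = j \<and> (\<forall>k<n. T $ p k $ p (Suc k) = 1)" for i j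
    using connecting_path[of i j] by metis
  then obtain N p where N: "\<And>i j. N i j \<ge> 1" and p: "\<And>i j. p i j 0 = i" "\<And>i j. p i j (N i j) = j"
    "\<And>i j k. k < N i j \<Longrightarrow> T $ p i j k $ p i j (Suc k) = 1"
    by metis
  define L where "L = Max (range (\<lambda>(i, j). N i j))"
  have L: "N i j \<le> L" for i j
    unfolding L_def by (intro Max_ge) (auto intro: rev_image_eqI[of "(i, j)"])
  show thesis
  proof (rule that[of L])
    fix n and w w' :: "nat \<Rightarrow> 's" assume w: "w \<in> \<Sigma>" "w' \<in> \<Sigma>"
    show "\<exists>v\<in>\<Sigma>. \<exists>l\<le>L. (\<forall>j<n. v j = w j) \<and> shift_by (n + l) v = w'"
    proof (cases n)
      case 0
      with w show ?thesis by (intro bexI[of _ w'] exI[of _ 0]) auto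
    next
      case (Suc m)
      \<comment> \<open>The connecting word begins with the last letter kept from \<open>w\<close>,
        so it is spliced in at \<open>m\<close> rather than at \<open>n\<close>, and the gap has
        length \<open>N i j - 1\<close>.\<close>
      define i j where "i = w m" and "j = w' 0"
      define v' where "v' = splice (N i j) (p i j) w'"
      have v': "v' \<in> \<Sigma>"
        unfolding v'_def
      proof (rule splice_in_space)
        have "T $ p i j (N i j - 1) $ p i j (Suc (N i j - 1)) = 1"
          using N[of i j] by (intro p) simp
        then show "T $ p i j (N i j - 1) $ w' 0 = 1"
          using N[of i j] p by (simp add: j_def)
      qed (use p w in auto)
      have v0: "v' 0 = i" using N[of i j] p by (simp add: v'_def splice_def)
      define v where "v = splice m w v'"
      have "v \<in> \<Sigma>"
        unfolding v_def
      proof (rule splice_in_space)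
        assume "m > 0"
        have "T $ w (m - 1) $ w (Suc (m - 1)) = 1" using w by (simp add: shift_space_def)
        with \<open>m > 0\<close> show "T $ w (m - 1) $ v' 0 = 1" by (simp add: v0 i_def)
      qed (use v' w in \<open>auto simp: shift_space_def\<close>)
      moreover have "v k = w k" if "k < n" for k
        using that v0 Suc by (auto simp: v_def splice_def i_def less_Suc_eq)
      moreover have "shift_by (n + (N i j - 1)) v = w'"
      proof -
        have "shift_by (n + (N i j - 1)) v = shift_by (N i j) (shift_by m v)"
          using Suc N[of i j] by simp
        also have "\<dots> = w'" by (simp add: v_def v'_def del: shift_by_shift_by)
        finally show ?thesis .
      qed
      moreover have "N i j - 1 \<le> L" using L[of i j] by simp
      ultimately show ?thesis by blast
    qed
  qed
qed

end

section \<open>Birkhoff sums and the ergodic minimum\<close>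

definition birkhoff :: "((nat \<Rightarrow> 's) \<Rightarrow> real) \<Rightarrow> nat \<Rightarrow> (nat \<Rightarrow> 's) \<Rightarrow> real" where
  "birkhoff \<phi> n w = (\<Sum>i<n. \<phi> (shift_by i w))"

lemma birkhoff_0 [simp]: "birkhoff \<phi> 0 w = 0"
  by (simp add: birkhoff_def)

lemma birkhoff_add: "birkhoff \<phi> (m + n) w = birkhoff \<phi> m w + birkhoff \<phi> n (shift_by m w)"
  by (induction n) (simp_all add: birkhoff_def)

lemma birkhoff_1 [simp]: "birkhoff \<phi> (Suc 0) w = \<phi> w"
  by (simp add: birkhoff_def)

section \<open>Hoelder potentials: bounded distortion and the minimal growth rate\<close>

locale holder_potential = irreducible_subshift T
  for T :: "nat ^ 's ^ 's::finite" +
  fixes lam \<theta> C :: real and \<phi> :: "(nat \<Rightarrow> 's) \<Rightarrow> real"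
  assumes lam: "0 < lam" "lam < 1" and theta: "0 < \<theta>" and C_nonneg: "0 \<le> C"
    and phi_holder: "\<And>w w'. w \<in> shift_space T \<Longrightarrow> w' \<in> shift_space T \<Longrightarrow>
      \<bar>\<phi> w - \<phi> w'\<bar> \<le> C * shift_dist lam w w' powr \<theta>"
begin

abbreviation dist_theta :: "(nat \<Rightarrow> 's) \<Rightarrow> (nat \<Rightarrow> 's) \<Rightarrow> real" where
  "dist_theta x x' \<equiv> shift_dist lam x x' powr \<theta>"

abbreviation S :: "nat \<Rightarrow> (nat \<Rightarrow> 's) \<Rightarrow> real" where "S \<equiv> birkhoff \<phi>"

definition q :: real where "q = lam powr \<theta>"

text \<open>The sum of the geometric series with terms \<open>C * q ^ i\<close>: a distortion
  constant valid for Birkhoff sums of every length.\<close>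

definition D :: real where "D = C / (1 - q)"

lemma q: "0 < q" "q < 1"
  using lam theta powr_less_mono2[of \<theta> lam 1] by (auto simp: q_def)

lemma D_nonneg: "0 \<le> D"
  using C_nonneg q by (simp add: D_def)

lemma dist_theta_le_1: "dist_theta x x' \<le> 1"
  using lam theta shift_dist_le_1[of lam x x'] shift_dist_nonneg[of lam x x'] by (simp add: powr_le1)

lemma dist_theta_shift:
  assumes "\<And>j. j < k \<Longrightarrow> w j = w' j"
  shows "dist_theta w w' = q ^ k * dist_theta (shift_by k w) (shift_by k w')"
proof -
  have "dist_theta w w' = (lam ^ k) powr \<theta> * dist_theta (shift_by k w) (shift_by k w')"
    using lam shift_dist_nonneg[of lam] by (simp add: shift_dist_shift[OF assms] powr_mult)
  also have "(lam ^ k) powr \<theta> = q ^ k"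
    using lam unfolding q_def by (simp add: powr_powr powr_realpow[symmetric] mult.commute)
  finally show ?thesis .
qed

text \<open>Orbits sharing their first \<open>n\<close> letters approach each other backwards in
  time: at time \<open>i\<close> their distance is \<open>q ^ (n - i)\<close> times that of the end
  points. The errors are summed as a geometric series, whence a bound independent of
  \<open>n\<close>.\<close>

lemma distortion:
  assumes "w \<in> \<Sigma>" "w' \<in> \<Sigma>" "\<And>j. j < n \<Longrightarrow> w j = w' j"
  shows "\<bar>S n w - S n w'\<bar> \<le> D * dist_theta (shift_by n w) (shift_by n w')"
proof -
  let ?d = "dist_theta (shift_by n w) (shift_by n w')"
  have "\<bar>\<phi> (shift_by i w) - \<phi> (shift_by i w')\<bar> \<le> C * q ^ (n - Suc i) * ?d" if "i < n" for i
  proof -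
    have "dist_theta (shift_by i w) (shift_by i w') =
        q ^ (n - i) * dist_theta (shift_by (n - i) (shift_by i w)) (shift_by (n - i) (shift_by i w'))"
      using assms(3) that by (intro dist_theta_shift) (auto simp: shift_by_apply)
    also have "\<dots> = q ^ (n - i) * ?d" using that by simp
    also have "\<dots> \<le> q ^ (n - Suc i) * ?d"
      using q by (intro mult_right_mono power_decreasing) auto
    finally have "C * dist_theta (shift_by i w) (shift_by i w') \<le> C * (q ^ (n - Suc i) * ?d)"
      using C_nonneg by (rule mult_left_mono)
    then show ?thesis
      using phi_holder[of "shift_by i w" "shift_by i w'"] assms
      by (simp add: shift_by_in_space mult.assoc)
  qed
  then have "\<bar>S n w - S n w'\<bar> \<le> (\<Sum>i<n. C * q ^ (n - Suc i) * ?d)"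
    unfolding birkhoff_def sum_subtractf[symmetric]
    by (intro order_trans[OF sum_abs] sum_mono) auto
  also have "\<dots> = C * (\<Sum>i<n. q ^ (n - Suc i)) * ?d"
    by (simp add: sum_distrib_left sum_distrib_right)
  also have "(\<Sum>i<n. q ^ (n - Suc i)) = (\<Sum>i<n. q ^ i)"
    by (rule sum.nat_diff_reindex)
  also have "\<dots> = (1 - q ^ n) / (1 - q)" using q by (simp add: sum_gp_strict)
  also have "C * ((1 - q ^ n) / (1 - q)) * ?d \<le> C * (1 / (1 - q)) * ?d"
    using q C_nonneg by (intro mult_right_mono mult_left_mono divide_right_mono) auto
  finally show ?thesis by (simp add: D_def)
qed

lemma phi_bounded: obtains B where "0 \<le> B" "\<And>w. w \<in> \<Sigma> \<Longrightarrow> \<bar>\<phi> w\<bar> \<le> B"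
proof -
  obtain w0 where w0: "w0 \<in> \<Sigma>" using space_nonempty by auto
  have "\<bar>\<phi> w\<bar> \<le> \<bar>\<phi> w0\<bar> + C" if "w \<in> \<Sigma>" for w
    using phi_holder[OF that w0] mult_left_mono[OF dist_theta_le_1[of w w0] C_nonneg] by linarith
  with C_nonneg show thesis by (intro that[of "\<bar>\<phi> w0\<bar> + C"]) auto
qed

lemma birkhoff_bounded:
  assumes "\<And>w. w \<in> \<Sigma> \<Longrightarrow> \<bar>\<phi> w\<bar> \<le> B" "w \<in> \<Sigma>"
  shows "\<bar>S n w\<bar> \<le> real n * B"
proof -
  have "\<bar>S n w\<bar> \<le> (\<Sum>i<n. B)"
    unfolding birkhoff_def using assms
    by (intro order_trans[OF sum_abs] sum_mono) (auto intro: shift_by_in_space)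
  then show ?thesis by simp
qed

text \<open>
  The infima of the Birkhoff sums are superadditive, and by gluing subadditive up to a constant, so
  they stay within bounded distance of a linear function of \<open>n\<close>.
\<close>

lemma ergodic_minimum:
  obtains c K where "\<And>n w. w \<in> \<Sigma> \<Longrightarrow> real n * c - K \<le> S n w"
    and "\<And>n. \<exists>w\<in>\<Sigma>. S n w \<le> real n * c + 1"
proof -
  obtain B where B: "0 \<le> B" "\<And>w. w \<in> \<Sigma> \<Longrightarrow> \<bar>\<phi> w\<bar> \<le> B" using phi_bounded by metis
  obtain L where L: "\<And>n w w'. w \<in> \<Sigma> \<Longrightarrow> w' \<in> \<Sigma> \<Longrightarrow>
    \<exists>v\<in>\<Sigma>. \<exists>l\<le>L. (\<forall>j<n. v j = w j) \<and> shift_by (n + l) v = w'" using gluing by metis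
  define a where "a n = (INF w\<in>\<Sigma>. S n w)" for n
  \<comment> \<open>\<open>D\<close> pays for replacing \<open>w\<close> by the glued point on the
    first block. The two terms \<open>real L * B\<close> pay for the inserted gap and for the last
    \<open>l\<close> steps, which lie beyond time \<open>m + n\<close>.\<close>
  define K where "K = D + 2 * (real L * B)"
  have bdd: "bdd_below (S n ` \<Sigma>)" for n
  proof (rule bdd_belowI2)
    show "- (real n * B) \<le> S n w" if "w \<in> \<Sigma>" for w
      using birkhoff_bounded[OF B(2) that, of n] by linarith
  qed
  have a_le: "a n \<le> S n w" if "w \<in> \<Sigma>" for n w
    unfolding a_def by (rule cINF_lower[OF bdd that])
  have a_ge: "r \<le> a n" if "\<And>w. w \<in> \<Sigma> \<Longrightarrow> r \<le> S n w" for r n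
    unfolding a_def using that by (intro cINF_greatest[OF space_nonempty])
  have super: "a m + a n \<le> a (m + n)" for m n
    using a_le by (intro a_ge) (auto simp: birkhoff_add intro!: add_mono shift_by_in_space)
  have sub: "a (m + n) \<le> a m + a n + K" for m n
  proof -
    have *: "a (m + n) - K - S m w \<le> S n w'" if w: "w \<in> \<Sigma>" "w' \<in> \<Sigma>" for w w'
    proof -
      obtain v l where v: "v \<in> \<Sigma>" "l \<le> L" "\<forall>j<m. v j = w j" "shift_by (m + l) v = w'"
        using L[OF w] by metis
      have "S (m + n) v + S l (shift_by (m + n) v) = S (m + l + n) v"
        by (metis add.assoc add.commute birkhoff_add)
      also have "\<dots> = S m v + S l (shift_by m v) + S n w'"
        using v by (simp add: birkhoff_add)
      finally have "S (m + n) v + S l (shift_by (m + n) v) = S m v + S l (shift_by m v) + S n w'" .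
      moreover have "\<bar>S m v - S m w\<bar> \<le> D"
        using distortion[OF v(1) w(1)] v(3) mult_left_mono[OF dist_theta_le_1 D_nonneg]
        by (smt (verit) mult.right_neutral)
      moreover have "\<bar>S l (shift_by i v)\<bar> \<le> real L * B" for i
        using birkhoff_bounded[OF B(2) shift_by_in_space[OF v(1)], of l i]
          mult_right_mono[of "real l" "real L" B] v(2) B(1) by force
      ultimately show ?thesis
        using a_le[OF v(1), of "m + n"] by (smt (verit, best) K_def)
    qed
    have "a (m + n) - K - S m w \<le> a n" if "w \<in> \<Sigma>" for w
      using *[OF that] by (rule a_ge)
    then have "a (m + n) - K - a n \<le> a m" by (intro a_ge) force
    then show ?thesis by linarith
  qed
  have mul1: "real n * a m \<le> a (n * m)" for n m
  proof (induction n)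
    case 0
    have "a 0 = 0" unfolding a_def using space_nonempty by simp
    then show ?case by simp
  next
    case (Suc n)
    then show ?case using super[of m "n * m"] by (simp add: algebra_simps)
  qed
  have mul2: "a (Suc n * m) \<le> real (Suc n) * (a m + K)" for n m
  proof (induction n)
    case 0
    have "0 \<le> K" using D_nonneg B(1) by (simp add: K_def)
    then show ?case by simp
  next
    case (Suc n)
    then show ?case using sub[of m "Suc n * m"] by (simp add: algebra_simps)
  qed
  \<comment> \<open>Both quotients are compared at the common time \<open>n * m\<close>. Every lower
    quotient thus lies below every upper one, and the supremum of the lower ones separates the two
    families.\<close>
  have key: "a m / real m \<le> (a n + K) / real n" if "m \<ge> 1" "n \<ge> 1" for m n
  proof -
    have "real n * a m \<le> real m * (a n + K)"
      using mul1[of n m] mul2[of "m - 1" n] that by (simp add: mult.commute)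
    then show ?thesis using that by (simp add: divide_simps mult.commute)
  qed
  define c where "c = (SUP m\<in>{1..}. a m / real m)"
  have cbdd: "bdd_above ((\<lambda>m. a m / real m) ` {1..})"
    using key[of _ 1] by (intro bdd_aboveI2[where M = "a 1 + K"]) auto
  have K0: "0 \<le> K" using D_nonneg B(1) by (simp add: K_def)
  have lower: "real n * c - K \<le> a n" for n
  proof (cases "n \<ge> 1")
    case True
    have "c \<le> (a n + K) / real n"
      unfolding c_def using key True by (intro cSUP_least) auto
    with True show ?thesis by (simp add: field_simps)
  next
    case False
    moreover have "a 0 = 0" unfolding a_def using space_nonempty by simp
    ultimately show ?thesis using K0 by (simp add: not_le)
  qed
  have upper: "a n \<le> real n * c" for n
  proof (cases "n \<ge> 1")
    case True
    have "a n / real n \<le> c"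
      unfolding c_def using True by (intro cSUP_upper cbdd) auto
    with True show ?thesis by (simp add: field_simps)
  next
    case False
    moreover have "a 0 = 0" unfolding a_def using space_nonempty by simp
    ultimately show ?thesis by (simp add: not_le)
  qed
  show thesis
  proof (rule that)
    show "real n * c - K \<le> S n w" if "w \<in> \<Sigma>" for n w
      using lower[of n] a_le[OF that, of n] by linarith
    show "\<exists>w\<in>\<Sigma>. S n w \<le> real n * c + 1" for n
    proof (rule ccontr)
      assume "\<not> ?thesis"
      then have "real n * c + 1 \<le> a n" by (intro a_ge) force
      with upper[of n] show False by linarith
    qed
  qed
qed

end

section \<open>Sub-actions of a Hoelder potential\<close>

context holder_potential
begin

definition solves :: "real \<Rightarrow> ((nat \<Rightarrow> 's) \<Rightarrow> real) \<Rightarrow> bool" where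
  "solves c u \<longleftrightarrow> (\<forall>w\<in>\<Sigma>. u (shift_by 1 w) \<le> u w + \<phi> w - c)"

definition defect :: "real \<Rightarrow> ((nat \<Rightarrow> 's) \<Rightarrow> real) \<Rightarrow> (nat \<Rightarrow> 's) \<Rightarrow> real" where
  "defect c u w = u w + \<phi> w - c - u (shift_by 1 w)"

text \<open>The constant is explicit because the later series of solutions needs one constant for
  all its terms.\<close>

definition holder_le :: "((nat \<Rightarrow> 's) \<Rightarrow> real) \<Rightarrow> real \<Rightarrow> bool" where
  "holder_le u H \<longleftrightarrow> (\<forall>x\<in>\<Sigma>. \<forall>x'\<in>\<Sigma>. \<bar>u x - u x'\<bar> \<le> H * dist_theta x x')"

lemma solves_defect: "solves c u \<longleftrightarrow> (\<forall>w\<in>\<Sigma>. 0 \<le> defect c u w)"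
  by (auto simp: solves_def defect_def algebra_simps)

lemma solves_iterate:
  assumes "solves c u" "w \<in> \<Sigma>"
  shows "u (shift_by k w) \<le> u w + S k w - real k * c"
proof (induction k)
  case (Suc k)
  have "u (shift_by 1 (shift_by k w)) \<le> u (shift_by k w) + \<phi> (shift_by k w) - c"
    using assms shift_by_in_space[OF assms(2)] unfolding solves_def by blast
  moreover have "S (Suc k) w = S k w + \<phi> (shift_by k w)" by (simp add: birkhoff_def)
  ultimately show ?case using Suc.IH by (simp add: algebra_simps)
qed simp

lemma holder_le_bounded:
  assumes "holder_le u H" "0 \<le> H"
  obtains B where "\<And>x. x \<in> \<Sigma> \<Longrightarrow> \<bar>u x\<bar> \<le> B"
proof -
  obtain x0 where x0: "x0 \<in> \<Sigma>" using space_nonempty by auto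
  have "\<bar>u x\<bar> \<le> \<bar>u x0\<bar> + H" if "x \<in> \<Sigma>" for x
  proof -
    have "\<bar>u x - u x0\<bar> \<le> H * dist_theta x x0" using assms that x0 by (auto simp: holder_le_def)
    then show ?thesis using mult_left_mono[OF dist_theta_le_1[of x x0] assms(2)] by linarith
  qed
  then show thesis by (rule that)
qed

text \<open>
  The largest solution of the sub-action inequality lying below \<open>g\<close>. It is meaningful only if the
  infima are finite.
\<close>

definition relax :: "real \<Rightarrow> ((nat \<Rightarrow> 's) \<Rightarrow> real) \<Rightarrow> (nat \<Rightarrow> 's) \<Rightarrow> real" where
  "relax c g y = Inf {g w + S k w - real k * c | k w. w \<in> \<Sigma> \<and> shift_by k w = y}"

lemma relax_le:
  assumes "\<And>k w. w \<in> \<Sigma> \<Longrightarrow> B \<le> g w + S k w - real k * c" "w \<in> \<Sigma>"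
  shows "relax c g (shift_by k w) \<le> g w + S k w - real k * c"
  unfolding relax_def using assms by (intro cInf_lower bdd_belowI[where m = B]) auto

lemma relax_ge:
  assumes "y \<in> \<Sigma>" "\<And>k w. w \<in> \<Sigma> \<Longrightarrow> shift_by k w = y \<Longrightarrow> r \<le> g w + S k w - real k * c"
  shows "r \<le> relax c g y"
  unfolding relax_def
proof (rule cInf_greatest)
  have "g y + S 0 y - real 0 * c \<in> {g w + S k w - real k * c | k w. w \<in> \<Sigma> \<and> shift_by k w = y}"
    using assms(1) shift_by_0 by blast
  then show "{g w + S k w - real k * c | k w. w \<in> \<Sigma> \<and> shift_by k w = y} \<noteq> {}" by blast
qed (use assms(2) in auto)

lemma relax_le_self:
  assumes "\<And>k w. w \<in> \<Sigma> \<Longrightarrow> B \<le> g w + S k w - real k * c" "w \<in> \<Sigma>"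
  shows "relax c g w \<le> g w"
  using relax_le[of B g c w 0] assms by simp

lemma solves_relax:
  assumes "\<And>k w. w \<in> \<Sigma> \<Longrightarrow> B \<le> g w + S k w - real k * c"
  shows "solves c (relax c g)"
  unfolding solves_def
proof
  fix w assume w: "w \<in> \<Sigma>"
  have "relax c g (shift_by 1 w) - \<phi> w + c \<le> relax c g w"
  proof (rule relax_ge[OF w])
    fix k v assume v: "v \<in> \<Sigma>" "shift_by k v = w"
    have "relax c g (shift_by (k + 1) v) \<le> g v + S (k + 1) v - real (k + 1) * c"
      using assms v(1) by (rule relax_le)
    also have "S (k + 1) v = S k v + \<phi> w" using v birkhoff_add[of \<phi> k 1 v] by simp
    finally show "relax c g (shift_by 1 w) - \<phi> w + c \<le> g v + S k v - real k * c"
      using v(2) by (auto simp: algebra_simps)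
  qed
  then show "relax c g (shift_by 1 w) \<le> relax c g w + \<phi> w - c" by linarith
qed

text \<open>If \<open>x\<close> and \<open>x'\<close> share the first letter, every history of
  \<open>x\<close> is also one of \<open>x'\<close>; the starting values then differ by the Hoelder
  bound for \<open>g\<close> and the costs by distortion. If the first letters differ, the distance
  is 1 and the oscillation \<open>M - B\<close> suffices.\<close>

lemma holder_le_relax:
  assumes bnd: "\<And>k w. w \<in> \<Sigma> \<Longrightarrow> B \<le> g w + S k w - real k * c"
    and g: "holder_le g G" "0 \<le> G" and M: "\<And>w. w \<in> \<Sigma> \<Longrightarrow> g w \<le> M"
  shows "holder_le (relax c g) (max (G + D) (M - B))"
proof -
  have range: "B \<le> relax c g x" "relax c g x \<le> M" if "x \<in> \<Sigma>" for x
    using relax_ge[OF that bnd] relax_le_self[OF bnd that] M[OF that] by auto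
  have one_side: "relax c g x' - (G + D) * dist_theta x x' \<le> relax c g x"
    if x: "x \<in> \<Sigma>" "x' \<in> \<Sigma>" "x 0 = x' 0" for x x'
  proof (rule relax_ge[OF x(1)])
    fix k w assume w: "w \<in> \<Sigma>" "shift_by k w = x"
    define w' where "w' = splice k w x'"
    have w': "w' \<in> \<Sigma>"
      unfolding w'_def
    proof (rule splice_in_space)
      assume "k > 0"
      have "T $ w (k - 1) $ w (Suc (k - 1)) = 1" using w(1) unfolding shift_space_def by blast
      moreover have "w k = x 0" using w(2) by (metis shift_by_apply add_0_right)
      ultimately show "T $ w (k - 1) $ x' 0 = 1" using \<open>k > 0\<close> x by simp
    qed (use w x in \<open>auto simp: shift_space_def\<close>)
    have agree: "\<And>j. j < k \<Longrightarrow> w j = w' j" by (simp add: w'_def)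
    have sh: "shift_by k w' = x'" by (simp add: w'_def)
    have "dist_theta w w' = q ^ k * dist_theta x x'"
      using dist_theta_shift[OF agree] w(2) sh by simp
    also have "\<dots> \<le> 1 * dist_theta x x'"
      using q by (intro mult_right_mono) (auto intro: power_le_one)
    finally have "G * dist_theta w w' \<le> G * dist_theta x x'"
      using g(2) by (simp add: mult_left_mono)
    then have "\<bar>g w - g w'\<bar> \<le> G * dist_theta x x'"
      using g(1) w(1) w' unfolding holder_le_def by (meson order_trans)
    moreover have "\<bar>S k w - S k w'\<bar> \<le> D * dist_theta x x'"
      using distortion[of w w' k] w w' agree sh by simp
    moreover have "relax c g x' \<le> g w' + S k w' - real k * c"
      using relax_le[OF bnd w', of k] sh by simp
    ultimately show "relax c g x' - (G + D) * dist_theta x x' \<le> g w + S k w - real k * c"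
      by (simp add: algebra_simps)
  qed
  show ?thesis
    unfolding holder_le_def
  proof (intro ballI)
    fix x x' assume x: "x \<in> \<Sigma>" "x' \<in> \<Sigma>"
    show "\<bar>relax c g x - relax c g x'\<bar> \<le> max (G + D) (M - B) * dist_theta x x'"
    proof (cases "x 0 = x' 0")
      case True
      have "\<bar>relax c g x - relax c g x'\<bar> \<le> (G + D) * dist_theta x x'"
        using one_side[OF x True] one_side[OF x(2,1) True[symmetric]]
          shift_dist_commute[of lam x x'] by (simp add: abs_le_iff)
      also have "\<dots> \<le> max (G + D) (M - B) * dist_theta x x'"
        by (intro mult_right_mono) auto
      finally show ?thesis .
    next
      case False
      then show ?thesis
        using range[OF x(1)] range[OF x(2)] shift_dist_neq_0[where x = x and x' = x' and lam = lam] False by auto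
    qed
  qed
qed

text \<open>The lower bound \<open>- K\<close> makes the infimal cost of reaching a point,
  \<open>relax c\<close> of the zero function, finite. The near-optimal orbits are carried along
  because they later identify \<open>c\<close>.\<close>

lemma subaction_exists:
  obtains c u H where "solves c u" "holder_le u H" "0 \<le> H"
    and "\<And>n. \<exists>w\<in>\<Sigma>. S n w \<le> real n * c + 1"
proof -
  obtain c K where c: "\<And>n w. w \<in> \<Sigma> \<Longrightarrow> real n * c - K \<le> S n w"
    "\<And>n. \<exists>w\<in>\<Sigma>. S n w \<le> real n * c + 1" by (rule ergodic_minimum) blast
  have bnd: "- K \<le> (\<lambda>_. 0) w + S k w - real k * c" if "w \<in> \<Sigma>" for k w
    using c(1)[OF that, of k] by simp
  have "holder_le (\<lambda>_. 0) 0" by (simp add: holder_le_def)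
  from holder_le_relax[OF bnd this, of 0] show thesis
    using solves_relax[OF bnd] c(2) D_nonneg by (intro that[of c "relax c (\<lambda>_. 0)" "max D K"]) auto
qed

text \<open>Indexed by lists over a finite alphabet, a countable type, so that all cylinders can be
  enumerated by \<open>from_nat\<close>.\<close>

definition cylinder :: "'s list \<Rightarrow> (nat \<Rightarrow> 's) set" where
  "cylinder p = {w. \<forall>j<length p. w j = p ! j}"

text \<open>Points separated by the cylinder differ at some position below \<open>length p\<close>,
  hence are at least \<open>q ^ length p\<close> apart in \<open>dist_theta\<close>. This height
  therefore gives Hoelder constant 1 for every \<open>p\<close>.\<close>

definition penalty :: "'s list \<Rightarrow> (nat \<Rightarrow> 's) \<Rightarrow> real" where
  "penalty p w = (if w \<in> cylinder p then 0 else q ^ length p)"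

text \<open>The analogue of \<open>nonwandering\<close> with \<open>\<phi>\<close> in place of the
  observable: a path becomes the orbit segment from \<open>w\<close> to
  \<open>shift_by k w\<close>.\<close>

definition nonwandering_potential :: "real \<Rightarrow> (nat \<Rightarrow> 's) set" where
  "nonwandering_potential c = {x \<in> \<Sigma>. \<forall>e>0. \<exists>k\<ge>1. \<exists>w\<in>\<Sigma>.
     shift_dist lam w x < e \<and> shift_dist lam (shift_by k w) x < e \<and> \<bar>S k w - real k * c\<bar> < e}"

lemma dist_theta_power:
  assumes "\<And>j. j < n \<Longrightarrow> x j = x' j"
  shows "dist_theta x x' \<le> q ^ n"
proof -
  have "dist_theta x x' = q ^ n * dist_theta (shift_by n x) (shift_by n x')"
    using assms by (rule dist_theta_shift)
  also have "\<dots> \<le> q ^ n" using q dist_theta_le_1 by (intro mult_left_le) auto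
  finally show ?thesis .
qed

lemma dist_theta_ge:
  assumes "x j \<noteq> x' j"
  shows "q ^ j \<le> dist_theta x x'"
proof -
  have "(lam ^ j) powr \<theta> \<le> dist_theta x x'"
    using lam theta shift_dist_ge[where x = x and x' = x' and j = j and lam = lam] assms
    by (intro powr_mono2) auto
  moreover have "(lam ^ j) powr \<theta> = q ^ j"
    using lam unfolding q_def by (simp add: powr_powr powr_realpow[symmetric] mult.commute)
  ultimately show ?thesis by simp
qed

lemma penalty_range: "0 \<le> penalty p w" "penalty p w \<le> 1"
  using q by (auto simp: penalty_def intro: power_le_one)

lemma penalty_holder: "\<bar>penalty p x - penalty p x'\<bar> \<le> dist_theta x x'"
proof (cases "x \<in> cylinder p \<longleftrightarrow> x' \<in> cylinder p")
  case False
  then obtain j where j: "j < length p" "x j \<noteq> x' j" unfolding cylinder_def mem_Collect_eq by metis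
  have "q ^ length p \<le> q ^ j" using j q by (intro power_decreasing) auto
  also have "\<dots> \<le> dist_theta x x'" using j by (intro dist_theta_ge)
  finally show ?thesis using q False by (auto simp: penalty_def)
qed (auto simp: penalty_def)

end

section \<open>Strict inequality over wandering cylinders\<close>

locale potential_with_subaction = holder_potential T lam \<theta> C \<phi>
  for T :: "nat ^ 's ^ 's::finite" and lam \<theta> C \<phi> +
  fixes c :: real and u0 :: "(nat \<Rightarrow> 's) \<Rightarrow> real" and H0 :: real
  assumes u0: "solves c u0" and u0_holder: "holder_le u0 H0" and H0: "0 \<le> H0"
begin

definition barrier :: "'s list \<Rightarrow> (nat \<Rightarrow> 's) \<Rightarrow> real" where
  "barrier p = relax c (\<lambda>w. u0 w + penalty p w)"

lemma penalized_ge: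
  "w \<in> \<Sigma> \<Longrightarrow> u0 (shift_by k w) + penalty p w \<le> u0 w + penalty p w + S k w - real k * c"
  using solves_iterate[OF u0, of w k] by linarith

text \<open>All constants are uniform in \<open>p\<close>, since every penalty has values between 0
  and 1 and Hoelder constant 1. Finiteness of the infima comes from \<open>u0\<close> being a
  bounded solution.\<close>

lemma barrier_bounds:
  obtains B H where "0 \<le> H" "\<And>p. solves c (barrier p)" "\<And>p. holder_le (barrier p) H"
    "\<And>p w. w \<in> \<Sigma> \<Longrightarrow> \<bar>barrier p w\<bar> \<le> B" "\<And>p w. w \<in> \<Sigma> \<Longrightarrow> barrier p w \<le> u0 w + penalty p w"
proof -
  obtain B where B: "\<And>x. x \<in> \<Sigma> \<Longrightarrow> \<bar>u0 x\<bar> \<le> B"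
    using holder_le_bounded[OF u0_holder H0] by blast
  have bnd: "- B \<le> u0 w + penalty p w + S k w - real k * c" if "w \<in> \<Sigma>" for p k w
    using penalized_ge[OF that, of k p] B[OF shift_by_in_space[OF that, of k]] penalty_range(1)[of p w]
    by linarith
  have M: "u0 w + penalty p w \<le> B + 1" if "w \<in> \<Sigma>" for p w
    using B[OF that] penalty_range(2)[of p w] by linarith
  have G: "holder_le (\<lambda>w. u0 w + penalty p w) (H0 + 1)" for p
    unfolding holder_le_def
  proof (intro ballI)
    fix x x' assume "x \<in> \<Sigma>" "x' \<in> \<Sigma>"
    then have "\<bar>u0 x - u0 x'\<bar> \<le> H0 * dist_theta x x'" using u0_holder by (simp add: holder_le_def)
    with penalty_holder[of p x x']
    show "\<bar>(u0 x + penalty p x) - (u0 x' + penalty p x')\<bar> \<le> (H0 + 1) * dist_theta x x'"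
      by (simp add: algebra_simps)
  qed
  define H where "H = max (H0 + 1 + D) (B + 1 - (- B))"
  have le: "barrier p w \<le> u0 w + penalty p w" if "w \<in> \<Sigma>" for p w
    unfolding barrier_def using bnd that by (rule relax_le_self)
  have ge: "- B \<le> barrier p w" if "w \<in> \<Sigma>" for p w
    unfolding barrier_def using bnd by (intro relax_ge that)
  show thesis
  proof (rule that[of H "B + 1"])
    show "0 \<le> H" using H0 D_nonneg by (simp add: H_def)
    show "solves c (barrier p)" for p unfolding barrier_def using bnd by (rule solves_relax)
    show "holder_le (barrier p) H" for p
      unfolding barrier_def H_def using bnd G _ M by (rule holder_le_relax) (use H0 in auto)
    show "\<bar>barrier p w\<bar> \<le> B + 1" if "w \<in> \<Sigma>" for p w
      using le[OF that, of p] ge[OF that, of p] M[OF that, of p] by linarith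
  qed (rule le)
qed

text \<open>
  If no orbit returns to the cylinder with small total cost, then leaving the cylinder is penalized
  and returning to it is expensive, so the infimum defining \<open>barrier p\<close> on the cylinder is attained
  by the empty path only.
\<close>

lemma defect_barrier:
  assumes e: "0 < e" "H0 * q ^ length p \<le> e / 2"
    and ret: "\<And>k w. k \<ge> 1 \<Longrightarrow> w \<in> \<Sigma> \<Longrightarrow> w \<in> cylinder p \<Longrightarrow> shift_by k w \<in> cylinder p \<Longrightarrow>
      e \<le> \<bar>S k w - real k * c\<bar>"
    and w: "w \<in> \<Sigma>" "shift_by 1 w \<in> cylinder p"
  shows "min (e / 2) (q ^ length p) \<le> defect c (barrier p) w"
proof -
  let ?m = "min (e / 2) (q ^ length p)"
  define x where "x = shift_by 1 w"
  have x: "x \<in> \<Sigma>" "x \<in> cylinder p" using w shift_by_in_space[OF w(1)] by (auto simp: x_def)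
  have "barrier p x \<le> u0 x + penalty p x" using barrier_bounds x(1) by metis
  then have up: "barrier p x \<le> u0 x" using x(2) by (simp add: penalty_def)
  have "u0 x + ?m - \<phi> w + c \<le> barrier p w"
    unfolding barrier_def
  proof (rule relax_ge[OF w(1)])
    fix k v assume v: "v \<in> \<Sigma>" "shift_by k v = w"
    \<comment> \<open>Prolonged by one step, a path to \<open>w\<close> becomes a path to
      \<open>x\<close> of positive length; so even the empty path to \<open>w\<close> is covered by
      the return hypothesis or by the penalty.\<close>
    then have vx: "shift_by (Suc k) v = x" unfolding x_def v(2)[symmetric] by simp
    have Sv: "S (Suc k) v = S k v + \<phi> w" using v birkhoff_add[of \<phi> k 1 v] by simp
    have pen: "u0 x + penalty p v \<le> u0 v + penalty p v + S (Suc k) v - real (Suc k) * c"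
      using penalized_ge[OF v(1), of "Suc k" p] vx by simp
    have "u0 x + ?m \<le> u0 v + penalty p v + S (Suc k) v - real (Suc k) * c"
    proof (cases "v \<in> cylinder p")
      case True
      then have "\<bar>u0 v - u0 x\<bar> \<le> H0 * dist_theta v x"
        using u0_holder v(1) x(1) by (simp add: holder_le_def)
      also have "\<dots> \<le> H0 * q ^ length p"
        using True x(2) H0 by (intro mult_left_mono dist_theta_power) (auto simp: cylinder_def)
      finally have near: "\<bar>u0 v - u0 x\<bar> \<le> e / 2" using e(2) by linarith
      \<comment> \<open>The hypothesis bounds only the absolute value. By \<open>pen\<close> the
        cost is at least \<open>- e / 2\<close>, which excludes cost at most \<open>- e\<close>;
        hence it is at least \<open>e\<close>, and \<open>e / 2\<close> is left after subtracting
        the oscillation of \<open>u0\<close>.\<close>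
      have "e \<le> \<bar>S (Suc k) v - real (Suc k) * c\<bar>"
        using ret[of "Suc k" v] v(1) True x(2) vx by simp
      then show ?thesis using near pen e(1) penalty_range(1)[of p v] by linarith
    next
      case False
      with pen show ?thesis by (simp add: penalty_def)
    qed
    then show "u0 x + ?m - \<phi> w + c \<le> u0 v + penalty p v + S k v - real k * c"
      using Sv by (simp add: algebra_simps)
  qed
  with up show ?thesis by (simp add: defect_def x_def)
qed

lemma wandering_cylinder:
  assumes "x \<in> \<Sigma>" "x \<notin> nonwandering_potential c"
  obtains p d where "x \<in> cylinder p" "0 < d"
    "\<And>w. w \<in> \<Sigma> \<Longrightarrow> shift_by 1 w \<in> cylinder p \<Longrightarrow> d \<le> defect c (barrier p) w"
proof -
  obtain e where e: "0 < e" "\<And>k w. k \<ge> 1 \<Longrightarrow> w \<in> \<Sigma> \<Longrightarrow> shift_dist lam w x < e \<Longrightarrow>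
      shift_dist lam (shift_by k w) x < e \<Longrightarrow> e \<le> \<bar>S k w - real k * c\<bar>"
    using assms unfolding nonwandering_potential_def by (smt (verit) mem_Collect_eq)
  have "(\<lambda>n. lam ^ n) \<longlonglongrightarrow> 0" using lam by (intro LIMSEQ_power_zero) auto
  then have l: "\<forall>\<^sub>F n in sequentially. lam ^ n < e" using e(1) by (rule order_tendstoD)
  have "(\<lambda>n. H0 * q ^ n) \<longlonglongrightarrow> H0 * 0" using q by (intro tendsto_mult_left LIMSEQ_power_zero) auto
  then have "\<forall>\<^sub>F n in sequentially. H0 * q ^ n < e / 2" using e(1) by (intro order_tendstoD) auto
  \<comment> \<open>The first condition puts the cylinder inside the ball of radius \<open>e\<close>
    around \<open>x\<close>, where returns are expensive; the second bounds the oscillation of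
    \<open>u0\<close> on it by half that expense.\<close>
  with l have "\<forall>\<^sub>F n in sequentially. lam ^ n < e \<and> H0 * q ^ n < e / 2" by eventually_elim auto
  then obtain n where n: "lam ^ n < e" "H0 * q ^ n < e / 2"
    by (auto simp: eventually_sequentially)
  define p where "p = map x [0..<n]"
  have close: "shift_dist lam w x < e" if "w \<in> cylinder p" for w
  proof -
    have "\<forall>j<n. w j = x j" using that by (auto simp: cylinder_def p_def)
    then show ?thesis using shift_dist_le_iff[OF lam, of w x n] n(1) by simp
  qed
  show thesis
  proof (rule that[of p "min (e / 2) (q ^ length p)"])
    show "x \<in> cylinder p" by (simp add: cylinder_def p_def)
    show "0 < min (e / 2) (q ^ length p)" using e(1) q by simp
    show "min (e / 2) (q ^ length p) \<le> defect c (barrier p) w"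
      if "w \<in> \<Sigma>" "shift_by 1 w \<in> cylinder p" for w
      using that e close n(2) by (intro defect_barrier) (auto simp: p_def)
  qed
qed

text \<open>The weights sum to 1, so a series of barriers keeps both the constant \<open>c\<close>
  and the common Hoelder constant. Defects are combined with the same weights and are nonnegative,
  so the defect of the sum dominates each weighted summand: a gap over a cylinder survives,
  multiplied by its weight.\<close>

lemma separating_potential:
  obtains u H where "solves c u" "holder_le u H" "0 \<le> H"
    "\<And>x. x \<in> \<Sigma> \<Longrightarrow> x \<notin> nonwandering_potential c \<Longrightarrow>
      \<exists>p d. x \<in> cylinder p \<and> 0 < d \<and> (\<forall>w\<in>\<Sigma>. shift_by 1 w \<in> cylinder p \<longrightarrow> d \<le> defect c u w)"
proof -
  obtain B H where BH: "0 \<le> H" "\<And>p. solves c (barrier p)" "\<And>p. holder_le (barrier p) H"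
    "\<And>p w. w \<in> \<Sigma> \<Longrightarrow> \<bar>barrier p w\<bar> \<le> B" by (rule barrier_bounds) blast
  define v where "v n = barrier (from_nat n)" for n
  define a :: "nat \<Rightarrow> real" where "a n = (1 / 2) ^ Suc n" for n
  have a_sums: "a sums 1" unfolding a_def by (rule power_half_series)
  have a_pos: "0 < a n" for n by (simp add: a_def)
  define u where "u x = (\<Sum>n. a n * v n x)" for x
  have sm: "summable (\<lambda>n. a n * v n x)" if "x \<in> \<Sigma>" for x
  proof (rule summable_comparison_test')
    show "summable (\<lambda>n. a n * B)" using a_sums by (intro summable_mult2) (rule sums_summable)
    show "norm (a n * v n x) \<le> a n * B" if "n \<ge> 0" for n
      using BH(4)[OF \<open>x \<in> \<Sigma>\<close>] a_pos[of n] by (simp add: abs_mult v_def)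
  qed
  then have u_sums: "(\<lambda>n. a n * v n x) sums u x" if "x \<in> \<Sigma>" for x
    unfolding u_def using that by (simp add: summable_sums)
  have holder: "holder_le u H"
    unfolding holder_le_def
  proof (intro ballI)
    fix x x' assume x: "x \<in> \<Sigma>" "x' \<in> \<Sigma>"
    let ?h = "H * dist_theta x x'"
    have d: "(\<lambda>n. a n * (v n x - v n x')) sums (u x - u x')"
      using sums_diff[OF u_sums[OF x(1)] u_sums[OF x(2)]] by (simp add: right_diff_distrib)
    have s: "(\<lambda>n. a n * ?h) sums (1 * ?h)" using a_sums by (rule sums_mult2)
    have s': "(\<lambda>n. - (a n * ?h)) sums - (1 * ?h)" using s by (rule sums_minus)
    have "\<bar>v n x - v n x'\<bar> \<le> ?h" for n
      using BH(3)[of "from_nat n"] x by (simp add: holder_le_def v_def)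
    then have vb: "v n x - v n x' \<le> ?h" "- ?h \<le> v n x - v n x'" for n
      by (simp_all add: abs_le_iff minus_le_iff)
    have b: "a n * (v n x - v n x') \<le> a n * ?h" "- (a n * ?h) \<le> a n * (v n x - v n x')" for n
      using mult_left_mono[OF vb(1), of "a n" n] mult_left_mono[OF vb(2), of "a n" n] a_pos[of n]
      by simp_all
    show "\<bar>u x - u x'\<bar> \<le> ?h"
      using sums_le[OF b(1) d s] sums_le[OF b(2) s' d] by (simp add: abs_le_iff)
  qed
  have defect: "(\<lambda>n. a n * defect c (v n) w) sums defect c u w" if w: "w \<in> \<Sigma>" for w
  proof -
    have "(\<lambda>n. a n * v n w + a n * (\<phi> w - c) - a n * v n (shift_by 1 w)) sums
        (u w + 1 * (\<phi> w - c) - u (shift_by 1 w))"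
      by (intro sums_diff sums_add u_sums w shift_by_in_space sums_mult2 a_sums)
    then show ?thesis by (simp add: defect_def algebra_simps)
  qed
  have nn: "0 \<le> a n * defect c (v n) w" if "w \<in> \<Sigma>" for n w
    using that BH(2)[of "from_nat n"] a_pos[of n] by (simp add: v_def solves_defect)
  have ge: "a n * defect c (v n) w \<le> defect c u w" if "w \<in> \<Sigma>" for n w
  proof -
    have "(\<Sum>i\<in>{n}. a i * defect c (v i) w) \<le> (\<Sum>i. a i * defect c (v i) w)"
      by (intro sum_le_suminf) (use that nn defect in \<open>auto intro: sums_summable\<close>)
    then show ?thesis using sums_unique[OF defect[OF that]] by simp
  qed
  show thesis
  proof (rule that[of u H])
    show "solves c u" unfolding solves_defect using nn ge by (meson order_trans)
    show "\<exists>p d. x \<in> cylinder p \<and> 0 < d \<and> (\<forall>w\<in>\<Sigma>. shift_by 1 w \<in> cylinder p \<longrightarrow> d \<le> defect c u w)"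
      if x: "x \<in> \<Sigma>" "x \<notin> nonwandering_potential c" for x
    proof -
      obtain p d where p: "x \<in> cylinder p" "0 < d"
        "\<And>w. w \<in> \<Sigma> \<Longrightarrow> shift_by 1 w \<in> cylinder p \<Longrightarrow> d \<le> defect c (barrier p) w"
        using wandering_cylinder[OF x] by metis
      have "a (to_nat p) * d \<le> defect c u w" if "w \<in> \<Sigma>" "shift_by 1 w \<in> cylinder p" for w
      proof -
        have "a (to_nat p) * d \<le> a (to_nat p) * defect c (v (to_nat p)) w"
          using p(3)[OF that] a_pos[of "to_nat p"] by (simp add: v_def)
        with ge[OF that(1)] show ?thesis by (meson order_trans)
      qed
      moreover have "0 < a (to_nat p) * d" using p(2) a_pos by simp
      ultimately show ?thesis using p(1) by blast
    qed
  qed (use holder BH(1) in auto)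
qed

end

section \<open>Compactness of the natural extension\<close>

text \<open>Diagonal extraction: at coordinate \<open>j\<close> the pigeonhole principle gives a
  subsequence that is constant there, and the diagonal sequence is a subsequence of it from index
  \<open>Suc j\<close> on.\<close>

lemma finite_alphabet_subsequence:
  fixes s :: "nat \<Rightarrow> nat \<Rightarrow> 'a::finite"
  obtains r l where "strict_mono r" "\<And>j. \<forall>\<^sub>F m in sequentially. s (r m) j = l j"
proof -
  interpret subseqs "\<lambda>j r. \<exists>a. \<forall>m. s (r m) j = a"
  proof
    fix n and t :: "nat \<Rightarrow> nat" assume "strict_mono t"
    have "finite (range (\<lambda>m. s (t m) n))" by simp
    then obtain m0 where inf: "infinite {m. s (t m) n = s (t m0) n}"
      using pigeonhole_infinite[of "UNIV :: nat set" "\<lambda>m. s (t m) n"] by auto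
    then obtain r' :: "nat \<Rightarrow> nat" where r': "strict_mono r'" "\<And>m. r' m \<in> {m. s (t m) n = s (t m0) n}"
      using infinite_enumerate by blast
    then have "\<forall>m. s ((t \<circ> r') m) n = s (t m0) n" by simp
    with r'(1) show "\<exists>r' :: nat \<Rightarrow> nat. strict_mono r' \<and> (\<exists>a. \<forall>m. s ((t \<circ> r') m) n = a)" by blast
  qed
  have "\<exists>a. \<forall>m. s ((diagseq \<circ> (+) (Suc j)) m) j = a" for j
    by (rule diagseq_holds) auto
  then obtain l where l: "\<And>j m. s (diagseq (Suc j + m)) j = l j"
    by (simp add: o_def) metis
  have "\<forall>\<^sub>F m in sequentially. s (diagseq m) j = l j" for j
  proof (rule eventually_sequentiallyI)
    fix n assume "Suc j \<le> n"
    then obtain m where "n = Suc j + m" by (auto simp: le_iff_add)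
    then show "s (diagseq n) j = l j" using l[of j m] by simp
  qed
  with subseq_diagseq show thesis by (rule that)
qed

definition agree :: "nat \<Rightarrow> 's bisequence \<Rightarrow> 's bisequence \<Rightarrow> bool" where
  "agree n z z' \<longleftrightarrow> (\<forall>j<n. fst z j = fst z' j \<and> snd z j = snd z' j)"

text \<open>Admissibility constrains only neighbouring letters, and a window of size
  \<open>Suc (Suc j)\<close> contains all letters that occur in the constraints at
  \<open>j\<close>.\<close>

lemma ext_space_limit:
  assumes "z \<in> ext_space T" "\<And>n. \<exists>z\<in>ext_space T. agree n z l"
  shows "l \<in> ext_space T"
proof -
  have "T $ fst l (Suc j) $ fst l j = 1 \<and> T $ snd l j $ snd l (Suc j) = 1 \<and> T $ fst l 0 $ snd l 0 = 1" for j
  proof -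
    obtain z where "z \<in> ext_space T" "agree (Suc (Suc j)) z l" using assms(2) by blast
    then show ?thesis
      by (auto simp: ext_space_def agree_def shift_space_def past_fibre_def past_space_def)
         (metis Suc_lessI lessI less_SucI zero_less_Suc)+
  qed
  then show ?thesis
    by (cases l) (auto simp: ext_space_def shift_space_def past_fibre_def past_space_def)
qed

lemma ext_space_subsequence:
  fixes z :: "nat \<Rightarrow> 's::finite bisequence"
  assumes "\<And>m. z m \<in> ext_space T"
  obtains r l where "l \<in> ext_space T" "strict_mono r"
    "\<And>n. \<forall>\<^sub>F m in sequentially. agree n (z (r m)) l"
proof -
  obtain r :: "nat \<Rightarrow> nat" and l where r: "strict_mono r" and
    l: "\<And>j. \<forall>\<^sub>F m in sequentially. (fst (z (r m)) j, snd (z (r m)) j) = l j"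
    using finite_alphabet_subsequence[of "\<lambda>m j. (fst (z m) j, snd (z m) j)"] by blast
  define l' where "l' = (\<lambda>j. fst (l j), \<lambda>j. snd (l j))"
  have ev: "\<forall>\<^sub>F m in sequentially. agree n (z (r m)) l'" for n
  proof -
    have "\<forall>\<^sub>F m in sequentially. \<forall>j\<in>{..<n}. (fst (z (r m)) j, snd (z (r m)) j) = l j"
      using l by (intro eventually_ball_finite) auto
    then show ?thesis
      by eventually_elim (auto simp: agree_def l'_def prod_eq_iff)
  qed
  have "l' \<in> ext_space T"
  proof (rule ext_space_limit)
    show "z 0 \<in> ext_space T" by (rule assms)
    show "\<exists>z\<in>ext_space T. agree n z l'" for n
      using eventually_happens'[OF _ ev[of n]] assms by auto
  qed
  with r ev show thesis by (intro that)
qed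

text \<open>The past metric carries an extra factor \<open>lam\<close>, so radius
  \<open>lam ^ Suc n\<close> controls \<open>n\<close> letters of the past but \<open>n + 1\<close>
  letters of the future.\<close>

lemma ext_dist_le_iff:
  assumes "0 < lam" "lam < 1"
  shows "ext_dist lam z z' \<le> lam ^ Suc n \<longleftrightarrow> agree n z z' \<and> snd z n = snd z' n"
proof -
  have "past_dist lam (fst z) (fst z') \<le> lam ^ Suc n \<longleftrightarrow> shift_dist lam (fst z) (fst z') \<le> lam ^ n"
    using assms by (simp add: past_dist_eq)
  then show ?thesis
    using shift_dist_le_iff[OF assms, of "fst z" "fst z'" n] shift_dist_le_iff[OF assms, of "snd z" "snd z'" "Suc n"]
    by (auto simp: ext_dist_def agree_def less_Suc_eq)
qed

lemma continuous_map_ext_iff: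
  assumes lam: "0 < lam" "lam < 1"
  shows "continuous_map (ext_top T lam) euclideanreal f \<longleftrightarrow>
    (\<forall>z\<in>ext_space T. \<forall>e>0. \<exists>n. \<forall>z'\<in>ext_space T. agree n z z' \<longrightarrow> \<bar>f z - f z'\<bar> < e)" (is "_ \<longleftrightarrow> ?R")
proof -
  interpret X: Metric_space "ext_space T" "ext_dist lam" by (rule Metric_space_ext[OF lam])
  have "continuous_map (ext_top T lam) euclideanreal f \<longleftrightarrow>
    (\<forall>z\<in>ext_space T. \<forall>e>0. \<exists>d>0. \<forall>z'. z' \<in> ext_space T \<and> ext_dist lam z z' < d \<longrightarrow> dist (f z) (f z') < e)"
    using X.metric_continuous_map[OF Met_TC.Metric_space_axioms] by simp
  also have "\<dots> \<longleftrightarrow> ?R"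
  proof (intro ball_cong refl all_cong1 imp_cong)
    fix z e assume z: "z \<in> ext_space T"
    show "(\<exists>d>0. \<forall>z'. z' \<in> ext_space T \<and> ext_dist lam z z' < d \<longrightarrow> dist (f z) (f z') < e) \<longleftrightarrow>
      (\<exists>n. \<forall>z'\<in>ext_space T. agree n z z' \<longrightarrow> \<bar>f z - f z'\<bar> < e)"
    proof
      assume "\<exists>d>0. \<forall>z'. z' \<in> ext_space T \<and> ext_dist lam z z' < d \<longrightarrow> dist (f z) (f z') < e"
      then obtain d where d: "0 < d" "\<And>z'. z' \<in> ext_space T \<Longrightarrow> ext_dist lam z z' < d \<Longrightarrow> \<bar>f z - f z'\<bar> < e"
        by (auto simp: dist_real_def)
      obtain n where "lam ^ n < d" using real_arch_pow_inv[OF d(1) lam(2)] by blast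
      moreover have "lam ^ Suc n \<le> lam ^ n" using lam by (intro power_decreasing) auto
      ultimately have n: "lam ^ Suc n < d" by linarith
      have "\<bar>f z - f z'\<bar> < e" if "z' \<in> ext_space T" "agree (Suc n) z z'" for z'
      proof -
        have "ext_dist lam z z' \<le> lam ^ Suc n"
          using that(2) ext_dist_le_iff[OF lam, of z z' n] by (auto simp: agree_def)
        with n have "ext_dist lam z z' < d" by linarith
        with that(1) show ?thesis by (rule d(2))
      qed
      then show "\<exists>n. \<forall>z'\<in>ext_space T. agree n z z' \<longrightarrow> \<bar>f z - f z'\<bar> < e" by blast
    next
      assume "\<exists>n. \<forall>z'\<in>ext_space T. agree n z z' \<longrightarrow> \<bar>f z - f z'\<bar> < e"
      then obtain n where n: "\<And>z'. z' \<in> ext_space T \<Longrightarrow> agree n z z' \<Longrightarrow> \<bar>f z - f z'\<bar> < e" by blast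
      show "\<exists>d>0. \<forall>z'. z' \<in> ext_space T \<and> ext_dist lam z z' < d \<longrightarrow> dist (f z) (f z') < e"
      proof (intro exI[of _ "lam ^ Suc n"] conjI allI impI)
        show "0 < lam ^ Suc n" using lam by simp
        fix z' assume "z' \<in> ext_space T \<and> ext_dist lam z z' < lam ^ Suc n"
        then show "dist (f z) (f z') < e"
          using n ext_dist_le_iff[OF lam, of z z' n] by (simp add: dist_real_def)
      qed
    qed
  qed
  finally show ?thesis .
qed

lemma continuous_map_shift_iff:
  assumes lam: "0 < lam" "lam < 1"
  shows "continuous_map (shift_top T lam) euclideanreal f \<longleftrightarrow>
    (\<forall>x\<in>shift_space T. \<forall>e>0. \<exists>n. \<forall>x'\<in>shift_space T. (\<forall>j<n. x j = x' j) \<longrightarrow> \<bar>f x - f x'\<bar> < e)"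
    (is "_ \<longleftrightarrow> ?R")
proof -
  interpret X: Metric_space "shift_space T" "shift_dist lam" by (rule Metric_space_shift[OF lam])
  have "continuous_map (shift_top T lam) euclideanreal f \<longleftrightarrow>
    (\<forall>x\<in>shift_space T. \<forall>e>0. \<exists>d>0. \<forall>x'. x' \<in> shift_space T \<and> shift_dist lam x x' < d \<longrightarrow> dist (f x) (f x') < e)"
    using X.metric_continuous_map[OF Met_TC.Metric_space_axioms] by simp
  also have "\<dots> \<longleftrightarrow> ?R"
  proof (intro ball_cong refl all_cong1 imp_cong)
    fix x e assume x: "x \<in> shift_space T"
    show "(\<exists>d>0. \<forall>x'. x' \<in> shift_space T \<and> shift_dist lam x x' < d \<longrightarrow> dist (f x) (f x') < e) \<longleftrightarrow>
      (\<exists>n. \<forall>x'\<in>shift_space T. (\<forall>j<n. x j = x' j) \<longrightarrow> \<bar>f x - f x'\<bar> < e)"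
    proof
      assume "\<exists>d>0. \<forall>x'. x' \<in> shift_space T \<and> shift_dist lam x x' < d \<longrightarrow> dist (f x) (f x') < e"
      then obtain d where d: "0 < d" "\<And>x'. x' \<in> shift_space T \<Longrightarrow> shift_dist lam x x' < d \<Longrightarrow> \<bar>f x - f x'\<bar> < e"
        by (auto simp: dist_real_def)
      obtain n where n: "lam ^ n < d" using real_arch_pow_inv[OF d(1) lam(2)] by blast
      have "\<bar>f x - f x'\<bar> < e" if "x' \<in> shift_space T" "\<forall>j<n. x j = x' j" for x'
        using that d(2) n shift_dist_le_iff[OF lam, of x x' n] by force
      then show "\<exists>n. \<forall>x'\<in>shift_space T. (\<forall>j<n. x j = x' j) \<longrightarrow> \<bar>f x - f x'\<bar> < e" by blast
    next
      assume "\<exists>n. \<forall>x'\<in>shift_space T. (\<forall>j<n. x j = x' j) \<longrightarrow> \<bar>f x - f x'\<bar> < e"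
      then obtain n where n: "\<And>x'. x' \<in> shift_space T \<Longrightarrow> \<forall>j<n. x j = x' j \<Longrightarrow> \<bar>f x - f x'\<bar> < e" by blast
      show "\<exists>d>0. \<forall>x'. x' \<in> shift_space T \<and> shift_dist lam x x' < d \<longrightarrow> dist (f x) (f x') < e"
      proof (intro exI[of _ "lam ^ n"] conjI allI impI)
        show "0 < lam ^ n" using lam by simp
        fix x' assume "x' \<in> shift_space T \<and> shift_dist lam x x' < lam ^ n"
        then show "dist (f x) (f x') < e"
          using n shift_dist_le_iff[OF lam, of x x' n] by (simp add: dist_real_def)
      qed
    qed
  qed
  finally show ?thesis .
qed

section \<open>Weak limits of empirical measures\<close>

text \<open>
  A Cantor-type encoding of sequences as real numbers: the base exceeds twice the alphabet size,
  so that the first differing digit dominates all later ones. It lets us borrow Helly's selection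
  theorem, which is available for measures on the real line.
\<close>

definition digit_base :: "'a::finite itself \<Rightarrow> real" where
  "digit_base _ = 1 / (2 * real CARD('a) + 1)"

definition encode :: "(nat \<Rightarrow> 'a::finite) \<Rightarrow> real" where
  "encode w = (\<Sum>i. digit_base TYPE('a) ^ i * real (to_nat_on (UNIV :: 'a set) (w i)))"

text \<open>Digit differences are at most \<open>N\<close>, so the tail is at most
  \<open>b ^ m * N / (1 - b)\<close>. For \<open>b = 1 / (2 * N + 1)\<close> the factor
  \<open>N / (1 - b)\<close> equals \<open>1 / (2 * b)\<close>: the tail is at most half the weight
  of the digit preceding it.\<close>

lemma encode_difference:
  fixes w w' :: "nat \<Rightarrow> 'a::finite"
  defines "b \<equiv> digit_base TYPE('a)" and "N \<equiv> real CARD('a)"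
    and "t \<equiv> \<lambda>i. real (to_nat_on (UNIV :: 'a set) (w i)) - real (to_nat_on (UNIV :: 'a set) (w' i))"
  shows "encode w - encode w' = (\<Sum>i<m. b ^ i * t i) + (\<Sum>i. b ^ (i + m) * t (i + m))"
    and "\<bar>\<Sum>i. b ^ (i + m) * t (i + m)\<bar> \<le> b ^ m * ((2 * N + 1) / 2)"
proof -
  have N: "N \<ge> 1" by (simp add: N_def Suc_leI)
  have b: "0 < b" "b < 1" using N by (auto simp: b_def digit_base_def N_def)
  have d: "real (to_nat_on (UNIV :: 'a set) a) \<le> N" for a
  proof -
    have "to_nat_on (UNIV :: 'a set) a \<in> {..<CARD('a)}"
      using bij_betwE[OF to_nat_on_finite[OF finite], of "UNIV :: 'a set"] by blast
    then show ?thesis by (simp add: N_def)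
  qed
  have sm: "summable (\<lambda>i. b ^ i * N)" using b by (intro summable_mult2 summable_geometric) auto
  have s: "summable (\<lambda>i. b ^ i * real (to_nat_on (UNIV :: 'a set) (v i)))" for v
    using b d by (intro summable_comparison_test'[OF sm]) (auto intro!: mult_left_mono)
  have td: "\<bar>t i\<bar> \<le> N" for i
    using d[of "w i"] d[of "w' i"] unfolding t_def by linarith
  have st: "summable (\<lambda>i. b ^ i * t i)"
    using summable_diff[OF s s] by (simp add: t_def right_diff_distrib)
  have "encode w - encode w' = (\<Sum>i. b ^ i * t i)"
    using suminf_diff[OF s s] unfolding encode_def b_def t_def by (simp add: right_diff_distrib)
  also have "\<dots> = (\<Sum>i<m. b ^ i * t i) + (\<Sum>i. b ^ (i + m) * t (i + m))"
    using suminf_split_initial_segment[OF st, of m] by simp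
  finally show "encode w - encode w' = (\<Sum>i<m. b ^ i * t i) + (\<Sum>i. b ^ (i + m) * t (i + m))" .
  have "(\<lambda>i. b ^ i * (b ^ m * N)) sums (1 / (1 - b) * (b ^ m * N))"
    using b by (intro sums_mult2 geometric_sums) auto
  moreover have "1 / (1 - b) * (b ^ m * N) = b ^ m * ((2 * N + 1) / 2)"
  proof -
    have "1 - b = 2 * N / (2 * N + 1)"
      using N unfolding b_def digit_base_def N_def[symmetric] by (simp add: field_simps)
    then have "1 / (1 - b) = (2 * N + 1) / (2 * N)" by simp
    then show ?thesis using N by simp
  qed
  ultimately have g: "(\<lambda>i. b ^ i * (b ^ m * N)) sums (b ^ m * ((2 * N + 1) / 2))" by (simp only:)
  have "norm (\<Sum>i. b ^ (i + m) * t (i + m)) \<le> (\<Sum>i. b ^ i * (b ^ m * N))"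
  proof (rule norm_suminf_le)
    show "norm (b ^ (n + m) * t (n + m)) \<le> b ^ n * (b ^ m * N)" for n
      using td b by (simp add: abs_mult power_add mult.assoc mult_left_mono)
    show "summable (\<lambda>i. b ^ i * (b ^ m * N))" using g by (rule sums_summable)
  qed
  with sums_unique[OF g] show "\<bar>\<Sum>i. b ^ (i + m) * t (i + m)\<bar> \<le> b ^ m * ((2 * N + 1) / 2)" by simp
qed

lemma encode_close:
  fixes w w' :: "nat \<Rightarrow> 'a::finite"
  assumes "\<And>j. j < n \<Longrightarrow> w j = w' j"
  shows "\<bar>encode w - encode w'\<bar> \<le> digit_base TYPE('a) ^ n * ((2 * real CARD('a) + 1) / 2)"
  using encode_difference[where m = n and w = w and w' = w'] assms by simp

text \<open>At the first differing position \<open>k\<close> the digits differ by a nonzero integer,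
  contributing at least the \<open>k\<close>-th power of the base, while all later digits together
  can cancel at most half of it.\<close>

lemma encode_separates:
  fixes w w' :: "nat \<Rightarrow> 'a::finite"
  assumes "\<bar>encode w - encode w'\<bar> < digit_base TYPE('a) ^ n / 2" "j \<le> n"
  shows "w j = w' j"
proof (rule ccontr)
  let ?b = "digit_base TYPE('a)"
  assume ne: "w j \<noteq> w' j"
  define k where "k = (LEAST j. w j \<noteq> w' j)"
  have k: "w k \<noteq> w' k" "k \<le> j" "\<And>i. i < k \<Longrightarrow> w i = w' i"
    using LeastI[of "\<lambda>j. w j \<noteq> w' j", OF ne] Least_le[of "\<lambda>j. w j \<noteq> w' j", OF ne] not_less_Least
    unfolding k_def by blast+
  define t where "t i = real (to_nat_on (UNIV :: 'a set) (w i)) - real (to_nat_on (UNIV :: 'a set) (w' i))" for i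
  have b: "0 < ?b" "?b \<le> 1" by (auto simp: digit_base_def)
  have "to_nat_on (UNIV :: 'a set) (w k) \<noteq> to_nat_on (UNIV :: 'a set) (w' k)"
    using k(1) by (simp add: countable_finite)
  then have "1 \<le> \<bar>t k\<bar>" unfolding t_def by linarith
  then have "?b ^ k \<le> \<bar>?b ^ k * t k\<bar>" using b by (simp add: abs_mult)
  moreover have "(\<Sum>i<Suc k. ?b ^ i * t i) = ?b ^ k * t k"
    using k(3) by (simp add: t_def)
  moreover have "\<bar>\<Sum>i. ?b ^ (i + Suc k) * t (i + Suc k)\<bar> \<le> ?b ^ k / 2"
  proof -
    have "?b * (2 * real CARD('a) + 1) = 1" by (simp add: digit_base_def add_nonneg_eq_0_iff)
    then have "?b ^ Suc k * ((2 * real CARD('a) + 1) / 2) = ?b ^ k / 2" by simp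
    then show ?thesis
      using encode_difference(2)[where w = w and w' = w' and m = "Suc k"] by (simp only: t_def)
  qed
  moreover have "encode w - encode w' = (\<Sum>i<Suc k. ?b ^ i * t i) + (\<Sum>i. ?b ^ (i + Suc k) * t (i + Suc k))"
    unfolding t_def by (rule encode_difference(1))
  ultimately have "?b ^ k / 2 \<le> \<bar>encode w - encode w'\<bar>" by linarith
  moreover have "?b ^ n \<le> ?b ^ k" using k(2) assms(2) b by (intro power_decreasing) auto
  ultimately show False using assms(1) by linarith
qed

text \<open>Past and future are merged into one sequence over the product alphabet. The two
  estimates say that \<open>h\<close> and its inverse on the image are uniformly continuous, with
  windows of agreement in place of a metric on bisequences.\<close>

lemma bisequence_encoding:
  obtains h :: "'s::finite bisequence \<Rightarrow> real" and b M :: real where "0 < b" "b < 1"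
    "\<And>n z z'. agree n z z' \<Longrightarrow> \<bar>h z - h z'\<bar> \<le> M * b ^ n"
    "\<And>n z z'. \<bar>h z - h z'\<bar> < b ^ n / 2 \<Longrightarrow> agree n z z'"
proof (rule that)
  let ?w = "\<lambda>z j. (fst z j, snd z j) :: 's \<times> 's"
  let ?b = "digit_base TYPE('s \<times> 's)"
  have "0 < real CARD('s \<times> 's)" by (simp only: of_nat_0_less_iff zero_less_card_finite)
  then show "0 < ?b" "?b < 1" by (auto simp only: digit_base_def divide_less_eq_1 zero_less_divide_iff)
  show "\<bar>encode (?w z) - encode (?w z')\<bar> \<le> ((2 * real CARD('s \<times> 's) + 1) / 2) * ?b ^ n"
    if "agree n z z'" for n z z'
    using encode_close[of n "?w z" "?w z'"] that by (simp add: agree_def mult.commute)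
  show "agree n z z'" if "\<bar>encode (?w z) - encode (?w z')\<bar> < ?b ^ n / 2" for n z z'
    using encode_separates[OF that] by (auto simp: agree_def)
qed

section \<open>Borel measures on the natural extension and Helly selection\<close>

lemma space_borel_on: "space (borel_on X) = topspace X"
  unfolding borel_on_def by (rule space_measure_of) (auto dest: openin_subset)

lemma sets_borel_on: "sets (borel_on X) = sigma_sets (topspace X) {U. openin X U}"
  unfolding borel_on_def by (rule sets_measure_of) (auto dest: openin_subset)

lemma continuous_map_borel_measurable:
  assumes "continuous_map X euclideanreal f"
  shows "f \<in> borel_measurable (borel_on X)"
proof (rule borel_measurableI)
  fix U :: "real set" assume "open U"
  then have "openin X {x \<in> topspace X. f x \<in> U}"
    using assms by (auto simp: continuous_map_def)
  moreover have "{x \<in> topspace X. f x \<in> U} = f -` U \<inter> space (borel_on X)"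
    by (auto simp: space_borel_on)
  ultimately show "f -` U \<inter> space (borel_on X) \<in> sets (borel_on X)"
    unfolding sets_borel_on by auto
qed

text \<open>The uniform measures on \<open>z n 0, ..., z n n\<close> are pushed to the line by the
  encoding \<open>h\<close>. Their supports lie in one compact set \<open>K\<close>, so they are
  tight and have a weakly convergent subsequence; its limit lives on \<open>K\<close> and is pulled
  back by the inverse of \<open>h\<close>.\<close>

lemma empirical_measures_limit:
  fixes z :: "nat \<Rightarrow> nat \<Rightarrow> 's::finite bisequence"
  assumes lam: "0 < lam" "lam < 1" and z: "\<And>n i. z n i \<in> ext_space T"
  obtains \<mu> r where "prob_space \<mu>" "sets \<mu> = sets (borel_on (ext_top T lam))" "strict_mono r"
    "\<And>f. continuous_map (ext_top T lam) euclideanreal f \<Longrightarrow>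
      (\<lambda>n. (\<Sum>i\<le>r n. f (z (r n) i)) / real (Suc (r n))) \<longlonglongrightarrow> (\<integral>x. f x \<partial>\<mu>)"
proof -
  let ?X = "ext_space T"
  interpret X: Metric_space ?X "ext_dist lam" by (rule Metric_space_ext[OF lam])
  obtain h :: "'s bisequence \<Rightarrow> real" and b M :: real where b: "0 < b" "b < 1"
    and h: "\<And>n z z'. agree n z z' \<Longrightarrow> \<bar>h z - h z'\<bar> \<le> M * b ^ n"
    and hs: "\<And>n z z'. \<bar>h z - h z'\<bar> < b ^ n / 2 \<Longrightarrow> agree n z z'"
    by (rule bisequence_encoding) blast
  have inj: "inj_on h ?X"
  proof (rule inj_onI)
    fix z z' assume "h z = h z'"
    then have "agree n z z'" for n using b by (intro hs) simp
    then have "fst z j = fst z' j \<and> snd z j = snd z' j" for j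
      unfolding agree_def by (metis lessI)
    then show "z = z'" by (simp add: prod_eq_iff fun_eq_iff)
  qed
  define K where "K = h ` ?X"
  have "compact K"
    unfolding compact_def
  proof (intro allI impI)
    fix s :: "nat \<Rightarrow> real" assume "\<forall>n. s n \<in> K"
    then have "\<forall>n. \<exists>v. v \<in> ?X \<and> s n = h v"
      unfolding K_def by blast
    from choice[OF this] obtain v where v: "\<And>n. v n \<in> ?X" "\<And>n. s n = h (v n)" by blast
    obtain r l where l: "l \<in> ?X" "strict_mono r" "\<And>n. \<forall>\<^sub>F m in sequentially. agree n (v (r m)) l"
      by (rule ext_space_subsequence[of v, OF v(1)]) blast
    have "(\<lambda>m. h (v (r m))) \<longlonglongrightarrow> h l"
    proof (rule tendstoI)
      fix e :: real assume e: "0 < e"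
      have "(\<lambda>n. M * b ^ n) \<longlonglongrightarrow> M * 0" using b by (intro tendsto_mult_left LIMSEQ_power_zero) auto
      then have "\<forall>\<^sub>F n in sequentially. M * b ^ n < e" using e by (intro order_tendstoD) auto
      then obtain n where n: "M * b ^ n < e" by (auto simp: eventually_sequentially)
      show "\<forall>\<^sub>F m in sequentially. dist (h (v (r m))) (h l) < e"
        using l(3)[of n]
      proof eventually_elim
        case (elim m)
        then show ?case using h[OF elim] n by (simp add: dist_real_def)
      qed
    qed
    with l v show "\<exists>l\<in>K. \<exists>r. strict_mono r \<and> (s \<circ> r) \<longlonglongrightarrow> l"
      by (intro bexI[of _ "h l"] exI[of _ r]) (auto simp: K_def o_def)
  qed
  then have "closed K" "bounded K" by (auto intro: compact_imp_closed compact_imp_bounded)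
  \<comment> \<open>The fixed point \<open>z 0 0\<close> is used off \<open>K\<close>, so that
    \<open>g\<close> maps the whole line into the space and remains Borel measurable.\<close>
  define g where "g t = (if t \<in> K then inv_into ?X h t else z 0 0)" for t
  have gX: "g t \<in> ?X" for t using z by (auto simp: g_def K_def inv_into_into)
  have gh: "g (h v) = v" if "v \<in> ?X" for v using that inj by (auto simp: g_def K_def)
  have hg: "h (g t) = t" if "t \<in> K" for t using that by (auto simp: g_def K_def f_inv_into_f)
  have g_cont: "continuous_map (top_of_set K) (ext_top T lam) g"
    unfolding X.continuous_map_to_metric
  proof (intro ballI allI impI)
    fix t e :: real assume t: "t \<in> topspace (top_of_set K)" and e: "0 < e"
    obtain n where n: "lam ^ n < e" using real_arch_pow_inv[OF e lam(2)] by blast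
    have "g s \<in> X.mball (g t) e" if "s \<in> K \<inter> ball t (b ^ Suc n / 2)" for s
    proof -
      have "\<bar>h (g t) - h (g s)\<bar> < b ^ Suc n / 2" using that t by (auto simp: hg dist_real_def)
      then have "agree (Suc n) (g t) (g s)" by (rule hs)
      then have "ext_dist lam (g t) (g s) \<le> lam ^ Suc n"
        using ext_dist_le_iff[OF lam, of "g t" "g s" n] by (auto simp: agree_def)
      also have "\<dots> \<le> lam ^ n" using lam by (intro power_decreasing) auto
      finally show ?thesis using n gX by (simp add: X.in_mball)
    qed
    then show "\<exists>U. openin (top_of_set K) U \<and> t \<in> U \<and> (\<forall>s\<in>U. g s \<in> X.mball (g t) e)"
      using t b by (intro exI[of _ "K \<inter> ball t (b ^ Suc n / 2)"]) auto
  qed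
  have g_meas: "g \<in> borel \<rightarrow>\<^sub>M borel_on (ext_top T lam)"
    unfolding borel_on_def
  proof (rule measurable_measure_of)
    show "{U. openin (ext_top T lam) U} \<subseteq> Pow (topspace (ext_top T lam))"
      using openin_subset by blast
    show "g \<in> space borel \<rightarrow> topspace (ext_top T lam)" using gX by auto
    fix U assume "U \<in> {U. openin (ext_top T lam) U}"
    then have "openin (top_of_set K) {t \<in> K. g t \<in> U}"
      using g_cont by (auto simp: continuous_map_def)
    then obtain V where "open V" "{t \<in> K. g t \<in> U} = K \<inter> V" by (auto simp: openin_open)
    then have m: "{t \<in> K. g t \<in> U} \<in> sets borel" using \<open>closed K\<close> by auto
    have "g -` U \<inter> space borel = {t \<in> K. g t \<in> U} \<union> (if z 0 0 \<in> U then - K else {})"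
      by (auto simp: g_def split: if_splits)
    with m \<open>closed K\<close> show "g -` U \<inter> space borel \<in> sets borel" by auto
  qed
  define \<nu> where "\<nu> n = distr (measure_pmf (pmf_of_set {..n})) borel (\<lambda>i. h (z n i))" for n
  have int_\<nu>: "(\<integral>t. F t \<partial>\<nu> n) = (\<Sum>i\<le>n. F (h (z n i))) / real (Suc n)"
    if "F \<in> borel_measurable borel" for F :: "real \<Rightarrow> real" and n
    unfolding \<nu>_def using that by (subst integral_distr) (auto simp: integral_pmf_of_set)
  have \<nu>_real: "real_distribution (\<nu> n)" for n
    unfolding \<nu>_def by (rule prob_space.real_distribution_distr) (auto simp: prob_space_measure_pmf)
  obtain R where R: "0 < R" "\<And>t. t \<in> K \<Longrightarrow> \<bar>t\<bar> < R"
    using \<open>bounded K\<close> unfolding bounded_pos_less by auto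
  have "tight \<nu>"
    unfolding tight_def
  proof (intro conjI allI impI \<nu>_real)
    fix e :: real assume e: "0 < e"
    have "measure (\<nu> n) {-R<..R} = 1" for n
    proof -
      have "h (z n i) \<in> K" for i using z by (simp add: K_def)
      then have "\<bar>h (z n i)\<bar> < R" for i by (rule R(2))
      then have "- R < h (z n i) \<and> h (z n i) \<le> R" for i by (meson abs_less_iff less_imp_le minus_less_iff)
      then have "(\<lambda>i. h (z n i)) -` {-R<..R} = UNIV" by auto
      then show ?thesis unfolding \<nu>_def by (subst measure_distr) auto
    qed
    with e R(1) show "\<exists>a b. a < b \<and> (\<forall>n. 1 - e < measure (\<nu> n) {a<..b})"
      by (intro exI[of _ "- R"] exI[of _ R]) auto
  qed
  from tight_imp_convergent_subsubsequence[OF this strict_mono_id] obtain r \<nu>' where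
    r: "strict_mono r" and \<nu>': "real_distribution \<nu>'" and conv: "weak_conv_m (\<lambda>n. \<nu> (r n)) \<nu>'"
    by (auto simp: o_def)
  interpret \<nu>': real_distribution \<nu>' by (rule \<nu>')
  have limit: "(\<lambda>n. (\<Sum>i\<le>r n. F (h (z (r n) i))) / real (Suc (r n))) \<longlonglongrightarrow> (\<integral>t. F t \<partial>\<nu>')"
    if F: "continuous_on UNIV F" "\<And>t. \<bar>F t\<bar> \<le> B" for F B
  proof -
    have "F \<in> borel_measurable borel" using F(1) by (rule borel_measurable_continuous_onI)
    note [simp] = int_\<nu>[OF this]
    have "(\<lambda>n. integral\<^sup>L (\<nu> (r n)) F) \<longlonglongrightarrow> (\<integral>t. F t \<partial>\<nu>')"
      using F \<nu>_real
      by (intro weak_conv_imp_integral_bdd_continuous_conv[OF _ \<nu>' conv, where B = B])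
         (auto simp: continuous_on_eq_continuous_at)
    then show ?thesis by simp
  qed
  have "K \<noteq> {}" using z unfolding K_def by blast
  \<comment> \<open>A bounded continuous function vanishing exactly on the closed set
    \<open>K\<close> has integral zero for all empirical measures, hence for the limit.\<close>
  have AE_K: "AE t in \<nu>'. t \<in> K"
  proof -
    let ?F = "\<lambda>t. min 1 (infdist t K)"
    have c: "continuous_on UNIV ?F" by (intro continuous_intros)
    have B: "\<bar>?F t\<bar> \<le> 1" for t using infdist_nonneg[of t K] by (simp add: abs_if min_def)
    have "h (z n i) \<in> K" for n i using z by (simp add: K_def)
    then have 0: "?F (h (z n i)) = 0" for n i by simp
    have "(\<integral>t. ?F t \<partial>\<nu>') = 0"
      using limit[OF c B] unfolding 0 by (intro LIMSEQ_unique[of "\<lambda>_. 0"]) auto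
    moreover have m: "?F \<in> borel_measurable \<nu>'"
      using borel_measurable_continuous_onI[OF c] by (simp cong: measurable_cong_sets)
    moreover have "integrable \<nu>' ?F"
      by (rule \<nu>'.integrable_const_bound[of _ 1]) (use B m in auto)
    ultimately have "AE t in \<nu>'. ?F t = 0"
      by (subst (asm) integral_nonneg_eq_0_iff_AE) (auto simp: infdist_nonneg)
    then show ?thesis
    proof (rule AE_mp, intro AE_I2 impI)
      fix t assume "?F t = 0"
      then have "infdist t K = 0" by (auto simp: min_def split: if_splits)
      then show "t \<in> K" using in_closed_iff_infdist_zero[OF \<open>closed K\<close> \<open>K \<noteq> {}\<close>] by blast
    qed
  qed
  have g_meas': "g \<in> \<nu>' \<rightarrow>\<^sub>M borel_on (ext_top T lam)"
    using g_meas by (simp cong: measurable_cong_sets)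
  define \<mu> where "\<mu> = distr \<nu>' (borel_on (ext_top T lam)) g"
  show thesis
  proof (rule that[of \<mu> r])
    show "prob_space \<mu>" unfolding \<mu>_def using g_meas' by (rule \<nu>'.prob_space_distr)
    show "sets \<mu> = sets (borel_on (ext_top T lam))" by (simp add: \<mu>_def)
    show "strict_mono r" by (rule r)
    fix f assume f: "continuous_map (ext_top T lam) euclideanreal f"
    have "continuous_map (top_of_set K) euclideanreal (f \<circ> g)"
      using g_cont f by (rule continuous_map_compose)
    then have fg: "continuous_on K (f \<circ> g)" by simp
    then have "bounded ((f \<circ> g) ` K)" using \<open>compact K\<close> by (intro compact_imp_bounded compact_continuous_image)
    then obtain B where B: "0 < B" "\<And>t. t \<in> K \<Longrightarrow> norm ((f \<circ> g) t) \<le> B"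
      unfolding bounded_pos by auto
    \<comment> \<open>Weak convergence requires test functions on the whole line, while
      \<open>f\<close> composed with \<open>g\<close> is known to be continuous only on
      \<open>K\<close>; Tietze extends it with the same bound.\<close>
    obtain F where F: "continuous_on UNIV F" "\<And>t. t \<in> K \<Longrightarrow> F t = (f \<circ> g) t"
      "\<And>t. t \<in> UNIV \<Longrightarrow> norm (F t) \<le> B"
      by (rule Tietze[OF fg, of UNIV B]) (use B \<open>closed K\<close> in auto)
    have fm: "f \<in> borel_measurable (borel_on (ext_top T lam))"
      using f by (rule continuous_map_borel_measurable)
    have "(\<integral>x. f x \<partial>\<mu>) = (\<integral>t. f (g t) \<partial>\<nu>')"
      unfolding \<mu>_def using g_meas' fm by (rule integral_distr)
    also have "\<dots> = (\<integral>t. F t \<partial>\<nu>')"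
    proof (rule integral_cong_AE)
      show "(\<lambda>t. f (g t)) \<in> borel_measurable \<nu>'" using g_meas' fm by (rule measurable_compose)
      show "F \<in> borel_measurable \<nu>'"
        using borel_measurable_continuous_onI[OF F(1)] by (simp cong: measurable_cong_sets)
      show "AE t in \<nu>'. f (g t) = F t"
        using AE_K by eventually_elim (simp add: F(2))
    qed
    finally have int: "(\<integral>x. f x \<partial>\<mu>) = (\<integral>t. F t \<partial>\<nu>')" .
    have "F (h (z n i)) = f (z n i)" for n i
      using F(2)[of "h (z n i)"] gh[OF z] z by (simp add: K_def)
    then show "(\<lambda>n. (\<Sum>i\<le>r n. f (z (r n) i)) / real (Suc (r n))) \<longlonglongrightarrow> (\<integral>x. f x \<partial>\<mu>)"
      unfolding int using limit[OF F(1), of B] F(3) by simp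
  qed
qed

section \<open>From observables to potentials\<close>

lemma ext_continuous_bounded:
  fixes T :: "nat ^ 's ^ 's::finite"
  assumes lam: "0 < lam" "lam < 1" and f: "continuous_map (ext_top T lam) euclideanreal f"
  obtains B where "\<And>z. z \<in> ext_space T \<Longrightarrow> \<bar>f z\<bar> \<le> B"
proof -
  have "\<exists>B. \<forall>z\<in>ext_space T. \<bar>f z\<bar> \<le> B"
  proof (rule ccontr)
    assume "\<not> ?thesis"
    then have "\<forall>n. \<exists>z. z \<in> ext_space T \<and> real n < \<bar>f z\<bar>" by (meson not_le)
    from choice[OF this] obtain v where v: "\<And>n. v n \<in> ext_space T" "\<And>n. real n < \<bar>f (v n)\<bar>" by blast
    obtain r l where l: "l \<in> ext_space T" "strict_mono r"
      "\<And>n. \<forall>\<^sub>F m in sequentially. agree n (v (r m)) l"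
      by (rule ext_space_subsequence[of v, OF v(1)]) blast
    obtain n where n: "\<And>z. z \<in> ext_space T \<Longrightarrow> agree n l z \<Longrightarrow> \<bar>f l - f z\<bar> < 1"
      using f l(1) unfolding continuous_map_ext_iff[OF lam] by (meson zero_less_one)
    have "\<forall>\<^sub>F m in sequentially. real m < \<bar>f l\<bar> + 1"
      using l(3)[of n]
    proof eventually_elim
      case (elim m)
      then have "agree n l (v (r m))" by (auto simp: agree_def)
      then have "\<bar>f l - f (v (r m))\<bar> < 1" using n v(1) by blast
      moreover have "real m \<le> real (r m)" using seq_suble[OF l(2)] by simp
      ultimately show ?case using v(2)[of "r m"] by linarith
    qed
    moreover have "\<forall>\<^sub>F m in sequentially. \<bar>f l\<bar> + 1 < real m"
      using filterlim_real_sequentially unfolding filterlim_at_top_dense by blast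
    ultimately have "\<forall>\<^sub>F m :: nat in sequentially. False" by eventually_elim linarith
    then show False by simp
  qed
  with that show thesis by blast
qed

lemma ext_continuous_integrable:
  fixes T :: "nat ^ 's ^ 's::finite"
  assumes lam: "0 < lam" "lam < 1" and "prob_space \<mu>" and sets: "sets \<mu> = sets (borel_on (ext_top T lam))"
    and f: "continuous_map (ext_top T lam) euclideanreal f"
  shows "integrable \<mu> f"
proof -
  interpret prob_space \<mu> by fact
  interpret X: Metric_space "ext_space T" "ext_dist lam" by (rule Metric_space_ext[OF lam])
  obtain B where B: "\<And>z. z \<in> ext_space T \<Longrightarrow> \<bar>f z\<bar> \<le> B"
    using ext_continuous_bounded[OF lam f] by blast
  have "space \<mu> = ext_space T"
    using sets_eq_imp_space_eq[OF sets] by (simp add: space_borel_on)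
  then have "AE z in \<mu>. norm (f z) \<le> B" using B by (intro AE_I2) simp
  moreover have "f \<in> borel_measurable \<mu>"
    using continuous_map_borel_measurable[OF f] by (simp cong: measurable_cong_sets add: sets)
  ultimately show ?thesis by (rule integrable_const_bound)
qed

lemma prepend_in_space: "(y, x) \<in> ext_space T \<Longrightarrow> prepend y x \<in> shift_space T"
  by (auto simp: ext_space_def past_fibre_def shift_space_def prepend_def split: nat.split)

lemma shift_by_prepend [simp]: "shift_by (Suc 0) (prepend y x) = x"
  by (simp add: shift_by_def prepend_def)

lemma prepend_0 [simp]: "prepend y x 0 = y 0"
  by (simp add: prepend_def)

lemma prepend_shift_by: "y 0 = w 0 \<Longrightarrow> prepend y (shift_by (Suc 0) w) = w"
  by (auto simp: prepend_def shift_by_def fun_eq_iff split: nat.split)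

lemma pair_in_ext_space:
  assumes "y \<in> past_space T" "w \<in> shift_space T" "y 0 = w 0"
  shows "(y, shift_by (Suc 0) w) \<in> ext_space T"
  using assms shift_by_in_space[OF assms(2), of "Suc 0"]
  by (auto simp: ext_space_def past_fibre_def shift_by_def shift_space_def)

locale holder_observable = irreducible_subshift T
  for T :: "nat ^ 's ^ 's::finite" +
  fixes lam \<theta> :: real and A :: "'s bisequence \<Rightarrow> real"
  assumes lam: "0 < lam" "lam < 1" and theta: "0 < \<theta>"
    and A_holder: "holder_on (ext_space T) (ext_dist lam) \<theta> A"
begin

text \<open>
  Only the first symbol of the past enters \<open>\<tau>\<^sub>y(x)\<close>, so the rest of the past can be minimized out.
\<close>

definition phi :: "(nat \<Rightarrow> 's) \<Rightarrow> real" where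
  "phi w = (INF y\<in>{y \<in> past_space T. y 0 = w 0}. A (y, shift_by 1 w))"

lemma A_bounds:
  obtains C where "0 \<le> C" "\<And>z z'. z \<in> ext_space T \<Longrightarrow> z' \<in> ext_space T \<Longrightarrow>
      \<bar>A z - A z'\<bar> \<le> C * ext_dist lam z z' powr \<theta>"
    "\<And>z z'. z \<in> ext_space T \<Longrightarrow> z' \<in> ext_space T \<Longrightarrow> \<bar>A z - A z'\<bar> \<le> C"
proof -
  interpret X: Metric_space "ext_space T" "ext_dist lam" by (rule Metric_space_ext[OF lam])
  obtain C where C: "\<And>z z'. z \<in> ext_space T \<Longrightarrow> z' \<in> ext_space T \<Longrightarrow>
      \<bar>A z - A z'\<bar> \<le> C * ext_dist lam z z' powr \<theta>"
    using A_holder by (auto simp: holder_on_def)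
  have "lam * shift_dist lam x x' \<le> 1 * 1" for x x' :: "nat \<Rightarrow> 's"
    using lam shift_dist_le_1[OF lam, of x x'] shift_dist_nonneg[of lam x x']
    by (intro mult_mono) auto
  then have "ext_dist lam z z' \<le> 1" for z z' :: "'s bisequence"
    using shift_dist_le_1[OF lam] by (simp add: ext_dist_def past_dist_eq)
  then have p1: "ext_dist lam z z' powr \<theta> \<le> 1" for z z' :: "'s bisequence"
    using theta X.nonneg[of z z'] by (simp add: powr_le1)
  have C': "\<bar>A z - A z'\<bar> \<le> \<bar>C\<bar> * ext_dist lam z z' powr \<theta>"
    if "z \<in> ext_space T" "z' \<in> ext_space T" for z z'
    using C[OF that] mult_right_mono[of C "\<bar>C\<bar>" "ext_dist lam z z' powr \<theta>"] by force
  moreover have "\<bar>A z - A z'\<bar> \<le> \<bar>C\<bar>" if "z \<in> ext_space T" "z' \<in> ext_space T" for z z'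
    using C'[OF that] mult_left_mono[OF p1[of z z'], of "\<bar>C\<bar>"] by simp
  ultimately show thesis by (intro that[of "\<bar>C\<bar>"]) auto
qed

lemma A_continuous: "continuous_map (ext_top T lam) euclideanreal A"
  unfolding continuous_map_ext_iff[OF lam]
proof (intro ballI allI impI)
  fix z and e :: real assume z: "z \<in> ext_space T" and e: "0 < e"
  obtain C where C: "0 \<le> C" "\<And>z z'. z \<in> ext_space T \<Longrightarrow> z' \<in> ext_space T \<Longrightarrow>
      \<bar>A z - A z'\<bar> \<le> C * ext_dist lam z z' powr \<theta>" by (rule A_bounds) blast
  have "(\<lambda>n. (lam powr \<theta>) ^ n) \<longlonglongrightarrow> 0"
    using lam theta powr_less_mono2[of \<theta> lam 1] by (intro LIMSEQ_power_zero) auto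
  then have "(\<lambda>n. C * (lam powr \<theta>) ^ n) \<longlonglongrightarrow> C * 0" by (rule tendsto_mult_left)
  then have "\<forall>\<^sub>F n in sequentially. C * (lam powr \<theta>) ^ n < e" using e by (intro order_tendstoD) auto
  then obtain n where n: "C * (lam powr \<theta>) ^ Suc n < e"
    unfolding eventually_sequentially by (meson le_SucI le_refl)
  have "\<bar>A z - A z'\<bar> < e" if "z' \<in> ext_space T" "agree (Suc n) z z'" for z'
  proof -
    interpret X: Metric_space "ext_space T" "ext_dist lam" by (rule Metric_space_ext[OF lam])
    have "ext_dist lam z z' \<le> lam ^ Suc n"
      using that(2) ext_dist_le_iff[OF lam, of z z' n] by (auto simp: agree_def)
    then have "ext_dist lam z z' powr \<theta> \<le> (lam ^ Suc n) powr \<theta>"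
      using theta X.nonneg by (intro powr_mono2) auto
    also have "\<dots> = (lam powr \<theta>) ^ Suc n"
      using lam by (simp only: powr_powr powr_realpow[symmetric] powr_gt_zero mult.commute)
    finally have "C * ext_dist lam z z' powr \<theta> \<le> C * (lam powr \<theta>) ^ Suc n"
      using C(1) by (rule mult_left_mono)
    with C(2)[OF z that(1)] n show ?thesis by linarith
  qed
  then show "\<exists>n. \<forall>z'\<in>ext_space T. agree n z z' \<longrightarrow> \<bar>A z - A z'\<bar> < e" by blast
qed

lemma phi_le:
  assumes "y \<in> past_space T" "w \<in> \<Sigma>" "y 0 = w 0"
  shows "phi w \<le> A (y, shift_by 1 w)"
proof -
  obtain C where C: "\<And>z z'. z \<in> ext_space T \<Longrightarrow> z' \<in> ext_space T \<Longrightarrow> \<bar>A z - A z'\<bar> \<le> C"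
    by (rule A_bounds) blast
  have "bdd_below ((\<lambda>y. A (y, shift_by 1 w)) ` {y \<in> past_space T. y 0 = w 0})"
  proof (rule bdd_belowI2)
    fix y' assume "y' \<in> {y \<in> past_space T. y 0 = w 0}"
    then have "\<bar>A (y, shift_by 1 w) - A (y', shift_by 1 w)\<bar> \<le> C"
      using assms by (intro C) (auto intro: pair_in_ext_space)
    then show "A (y, shift_by 1 w) - C \<le> A (y', shift_by 1 w)" by linarith
  qed
  then show ?thesis unfolding phi_def using assms by (intro cINF_lower) auto
qed

lemma phi_ge:
  assumes "\<And>y. y \<in> past_space T \<Longrightarrow> y 0 = w 0 \<Longrightarrow> r \<le> A (y, shift_by 1 w)"
  shows "r \<le> phi w"
  unfolding phi_def using ex_past[of "w 0"] assms by (intro cINF_greatest) auto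

text \<open>Stands in for a minimizing past; its applications let the total error, or the average
  error, become arbitrarily small.\<close>

lemma phi_approx:
  assumes "0 < e"
  obtains y where "y \<in> past_space T" "y 0 = w 0" "A (y, shift_by 1 w) < phi w + e"
proof (rule ccontr)
  assume "\<not> thesis"
  then have "phi w + e \<le> phi w" using that by (intro phi_ge) force
  with assms show False by simp
qed

lemma phi_prepend_le:
  assumes "(y, x) \<in> ext_space T"
  shows "phi (prepend y x) \<le> A (y, x)"
  using phi_le[of y "prepend y x"] assms prepend_in_space[OF assms]
  by (auto simp: ext_space_def past_fibre_def)

text \<open>If the first letters agree, the same past can be used for both points, and removing that
  letter divides the distance by \<open>lam\<close>; hence the factor \<open>1 / q\<close>. If they
  differ, the distance is 1 and the oscillation bound \<open>C\<close> suffices.\<close>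

lemma phi_holder_ex:
  "\<exists>C\<ge>0. \<forall>w\<in>\<Sigma>. \<forall>w'\<in>\<Sigma>. \<bar>phi w - phi w'\<bar> \<le> C * shift_dist lam w w' powr \<theta>"
proof -
  obtain C where C: "0 \<le> C" "\<And>z z'. z \<in> ext_space T \<Longrightarrow> z' \<in> ext_space T \<Longrightarrow>
      \<bar>A z - A z'\<bar> \<le> C * ext_dist lam z z' powr \<theta>"
    "\<And>z z'. z \<in> ext_space T \<Longrightarrow> z' \<in> ext_space T \<Longrightarrow> \<bar>A z - A z'\<bar> \<le> C" by (rule A_bounds) blast
  define q where "q = lam powr \<theta>"
  have q: "0 < q" "q \<le> 1" using lam theta by (auto simp: q_def intro: powr_le1)
  have "C * 1 \<le> C * (1 / q)" using C(1) q by (intro mult_left_mono) (auto simp: field_simps)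
  then have Cq: "C \<le> C / q" by simp
  have one_side: "phi w - C / q * shift_dist lam w w' powr \<theta> \<le> phi w'" if w: "w \<in> \<Sigma>" "w' \<in> \<Sigma>" for w w'
  proof (rule phi_ge)
    fix y' assume y': "y' \<in> past_space T" "y' 0 = w' 0"
    show "phi w - C / q * shift_dist lam w w' powr \<theta> \<le> A (y', shift_by 1 w')"
    proof (cases "w 0 = w' 0")
      case True
      have sd: "shift_dist lam w w' = lam * shift_dist lam (shift_by 1 w) (shift_by 1 w')"
        using shift_dist_shift[of 1 w w' lam] True by simp
      have "ext_dist lam (y', shift_by 1 w) (y', shift_by 1 w') = shift_dist lam (shift_by 1 w) (shift_by 1 w')"
        using lam shift_dist_nonneg[of lam "shift_by 1 w" "shift_by 1 w'"] by (simp add: ext_dist_def past_dist_def)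
      moreover have "shift_dist lam w w' powr \<theta> = q * shift_dist lam (shift_by 1 w) (shift_by 1 w') powr \<theta>"
        using lam shift_dist_nonneg[of lam] by (simp add: sd powr_mult q_def)
      ultimately have "C / q * shift_dist lam w w' powr \<theta> =
          C * ext_dist lam (y', shift_by 1 w) (y', shift_by 1 w') powr \<theta>"
        using q by simp
      moreover have "\<bar>A (y', shift_by 1 w) - A (y', shift_by 1 w')\<bar> \<le>
          C * ext_dist lam (y', shift_by 1 w) (y', shift_by 1 w') powr \<theta>"
        using w y' True by (intro C(2)) (auto intro: pair_in_ext_space)
      moreover have "phi w \<le> A (y', shift_by 1 w)" using w y' True by (intro phi_le) auto
      ultimately show ?thesis by linarith
    next
      case False
      then have sd: "shift_dist lam w w' powr \<theta> = 1" by (simp add: shift_dist_neq_0)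
      obtain y where y: "y \<in> past_space T" "y 0 = w 0" using ex_past by blast
      have "\<bar>A (y, shift_by 1 w) - A (y', shift_by 1 w')\<bar> \<le> C"
        using w y y' by (intro C(3)) (auto intro: pair_in_ext_space)
      moreover have "phi w \<le> A (y, shift_by 1 w)" using w y by (intro phi_le)
      ultimately show ?thesis using Cq unfolding sd by linarith
    qed
  qed
  have "\<bar>phi w - phi w'\<bar> \<le> C / q * shift_dist lam w w' powr \<theta>" if "w \<in> \<Sigma>" "w' \<in> \<Sigma>" for w w'
    using one_side[OF that] one_side[OF that(2,1)] shift_dist_commute[of lam w w'] by simp
  with C(1) q show ?thesis by (intro exI[of _ "C / q"]) auto
qed

text \<open>A constant fixed once, as a term in the locale parameters, so that
  \<open>holder_potential\<close> can be instantiated.\<close>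

definition phi_const :: real where
  "phi_const = (SOME C. 0 \<le> C \<and>
     (\<forall>w\<in>\<Sigma>. \<forall>w'\<in>\<Sigma>. \<bar>phi w - phi w'\<bar> \<le> C * shift_dist lam w w' powr \<theta>))"

end

sublocale holder_observable \<subseteq> holder_potential T lam \<theta> phi_const phi
proof -
  have "0 \<le> phi_const \<and> (\<forall>w\<in>\<Sigma>. \<forall>w'\<in>\<Sigma>. \<bar>phi w - phi w'\<bar> \<le> phi_const * shift_dist lam w w' powr \<theta>)"
    unfolding phi_const_def by (rule someI_ex[OF phi_holder_ex])
  then show "holder_potential T lam \<theta> phi_const phi"
    using lam theta by unfold_locales auto
qed

section \<open>Identification of the holonomic minimum\<close>

context holder_observable
begin

lemma snd_in_space: "z \<in> ext_space T \<Longrightarrow> snd z \<in> \<Sigma>"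
  by (auto simp: ext_space_def)

lemma continuous_map_snd:
  assumes "continuous_map (shift_top T lam) euclideanreal f"
  shows "continuous_map (ext_top T lam) euclideanreal (\<lambda>z. f (snd z))"
  unfolding continuous_map_ext_iff[OF lam]
proof (intro ballI allI impI)
  fix z and e :: real assume z: "z \<in> ext_space T" and e: "0 < e"
  obtain n where "\<And>x'. x' \<in> \<Sigma> \<Longrightarrow> \<forall>j<n. snd z j = x' j \<Longrightarrow> \<bar>f (snd z) - f x'\<bar> < e"
    using assms snd_in_space[OF z] e unfolding continuous_map_shift_iff[OF lam] by meson
  then show "\<exists>n. \<forall>z'\<in>ext_space T. agree n z z' \<longrightarrow> \<bar>f (snd z) - f (snd z')\<bar> < e"
    by (intro exI[of _ n]) (simp add: agree_def snd_in_space)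
qed

lemma continuous_map_prepend:
  assumes "continuous_map (shift_top T lam) euclideanreal f"
  shows "continuous_map (ext_top T lam) euclideanreal (\<lambda>z. f (prepend (fst z) (snd z)))"
  unfolding continuous_map_ext_iff[OF lam]
proof (intro ballI allI impI)
  fix z and e :: real assume z: "z \<in> ext_space T" and e: "0 < e"
  have pz: "prepend (fst z) (snd z) \<in> \<Sigma>" if "z \<in> ext_space T" for z
    using that prepend_in_space[of "fst z" "snd z" T] by simp
  obtain n where n: "\<And>x'. x' \<in> \<Sigma> \<Longrightarrow> \<forall>j<n. prepend (fst z) (snd z) j = x' j \<Longrightarrow>
      \<bar>f (prepend (fst z) (snd z)) - f x'\<bar> < e"
    using assms pz[OF z] e unfolding continuous_map_shift_iff[OF lam] by meson
  have "\<forall>j<n. prepend (fst z) (snd z) j = prepend (fst z') (snd z') j" if "agree (Suc n) z z'" for z'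
    using that by (auto simp: prepend_def agree_def split: nat.split)
  with n pz show "\<exists>n. \<forall>z'\<in>ext_space T. agree n z z' \<longrightarrow>
      \<bar>f (prepend (fst z) (snd z)) - f (prepend (fst z') (snd z'))\<bar> < e" by meson
qed

lemma holder_continuous:
  assumes "holder_le u H" "0 \<le> H"
  shows "continuous_map (shift_top T lam) euclideanreal u"
  unfolding continuous_map_shift_iff[OF lam]
proof (intro ballI allI impI)
  fix x and e :: real assume x: "x \<in> \<Sigma>" and e: "0 < e"
  have "(\<lambda>n. H * q ^ n) \<longlonglongrightarrow> H * 0" using q by (intro tendsto_mult_left LIMSEQ_power_zero) auto
  then have "\<forall>\<^sub>F n in sequentially. H * q ^ n < e" using e by (intro order_tendstoD) auto
  then obtain n where n: "H * q ^ n < e" by (auto simp: eventually_sequentially)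
  have "\<bar>u x - u x'\<bar> < e" if "x' \<in> \<Sigma>" "\<forall>j<n. x j = x' j" for x'
  proof -
    have "\<bar>u x - u x'\<bar> \<le> H * dist_theta x x'" using assms(1) x that(1) by (simp add: holder_le_def)
    also have "\<dots> \<le> H * q ^ n" using that assms(2) by (intro mult_left_mono dist_theta_power) auto
    finally show ?thesis using n by simp
  qed
  then show "\<exists>n. \<forall>x'\<in>\<Sigma>. (\<forall>j<n. x j = x' j) \<longrightarrow> \<bar>u x - u x'\<bar> < e" by blast
qed

text \<open>Integrating the sub-action inequality, the two terms in \<open>u\<close> cancel: this is
  the holonomy condition for the test function \<open>u\<close>.\<close>

lemma holonomic_integral_ge:
  assumes u: "solves c u" "holder_le u H" "0 \<le> H" and \<mu>: "\<mu> \<in> holonomic_measures T lam"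
  shows "c \<le> (\<integral>z. A z \<partial>\<mu>)"
proof -
  have "prob_space \<mu>" and sets: "sets \<mu> = sets (borel_on (ext_top T lam))"
    using \<mu> by (auto simp: holonomic_measures_def)
  then interpret prob_space \<mu> by simp
  interpret X: Metric_space "ext_space T" "ext_dist lam" by (rule Metric_space_ext[OF lam])
  have sp: "space \<mu> = ext_space T"
    using sets_eq_imp_space_eq[OF sets] by (simp add: space_borel_on)
  note integrable = ext_continuous_integrable[OF lam \<open>prob_space \<mu>\<close> sets]
  have cu: "continuous_map (shift_top T lam) euclideanreal u" using u by (intro holder_continuous)
  note ints = integrable[OF continuous_map_snd[OF cu]] integrable[OF continuous_map_prepend[OF cu]]
    integrable[OF A_continuous]
  have "(\<integral>z. u (snd z) - u (prepend (fst z) (snd z)) + c \<partial>\<mu>) \<le> (\<integral>z. A z \<partial>\<mu>)"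
  proof (rule integral_mono)
    fix z assume "z \<in> space \<mu>"
    then have z: "(fst z, snd z) \<in> ext_space T" by (simp add: sp)
    show "u (snd z) - u (prepend (fst z) (snd z)) + c \<le> A z"
      using u(1) prepend_in_space[OF z] phi_prepend_le[OF z] unfolding solves_def by force
  qed (use ints in auto)
  moreover have "(\<integral>z. u (snd z) - u (prepend (fst z) (snd z)) + c \<partial>\<mu>) = c"
    using ints \<mu> cu by (simp add: holonomic_measures_def prob_space)
  ultimately show ?thesis by simp
qed

text \<open>Empirical measures along longer and longer near-optimal orbits, each point equipped with
  a near-optimal past. The difference of the two sides of the holonomy condition telescopes to two
  boundary terms divided by the length, so it vanishes in the limit.\<close>

lemma minimizing_measure_exists:
  assumes "\<And>n. \<exists>w\<in>\<Sigma>. S n w \<le> real n * c + 1"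
  obtains \<mu> where "\<mu> \<in> holonomic_measures T lam" "(\<integral>z. A z \<partial>\<mu>) \<le> c"
proof -
  obtain w where w: "\<And>n. w n \<in> \<Sigma>" "\<And>n. S (Suc n) (w n) \<le> real (Suc n) * c + 1"
  proof -
    have "\<forall>n. \<exists>w. w \<in> \<Sigma> \<and> S (Suc n) w \<le> real (Suc n) * c + 1" using assms by blast
    from choice[OF this] that show ?thesis by blast
  qed
  have "\<forall>n i. \<exists>y. y \<in> past_space T \<and> y 0 = w n i \<and>
      A (y, shift_by (Suc i) (w n)) \<le> phi (shift_by i (w n)) + 1 / real (Suc n)"
  proof (intro allI)
    fix n i
    obtain y where "y \<in> past_space T" "y 0 = shift_by i (w n) 0"
      "A (y, shift_by 1 (shift_by i (w n))) < phi (shift_by i (w n)) + 1 / real (Suc n)"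
      by (rule phi_approx[of "1 / real (Suc n)" "shift_by i (w n)"]) auto
    then show "\<exists>y. y \<in> past_space T \<and> y 0 = w n i \<and>
        A (y, shift_by (Suc i) (w n)) \<le> phi (shift_by i (w n)) + 1 / real (Suc n)"
      by (intro exI[of _ y]) (auto simp: shift_by_apply)
  qed
  then obtain y where y: "\<And>n i. y n i \<in> past_space T" "\<And>n i. y n i 0 = w n i"
    "\<And>n i. A (y n i, shift_by (Suc i) (w n)) \<le> phi (shift_by i (w n)) + 1 / real (Suc n)"
    by metis
  define z where "z n i = (y n i, shift_by (Suc i) (w n))" for n i
  have z: "z n i \<in> ext_space T" for n i
    using pair_in_ext_space[OF y(1)[of n i] shift_by_in_space[OF w(1)[of n], of i]] y(2)[of n i]
    by (simp add: z_def shift_by_apply)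
  have pz: "prepend (fst (z n i)) (snd (z n i)) = shift_by i (w n)" for n i
    using prepend_shift_by[of "y n i" "shift_by i (w n)"] y(2)[of n i] by (simp add: z_def shift_by_apply)
  obtain \<mu> r where \<mu>: "prob_space \<mu>" "sets \<mu> = sets (borel_on (ext_top T lam))" and r: "strict_mono r"
    and lim: "\<And>f. continuous_map (ext_top T lam) euclideanreal f \<Longrightarrow>
      (\<lambda>n. (\<Sum>i\<le>r n. f (z (r n) i)) / real (Suc (r n))) \<longlonglongrightarrow> (\<integral>x. f x \<partial>\<mu>)"
    by (rule empirical_measures_limit[OF lam, of z, OF z]) blast
  have inv0: "(\<lambda>n. K / real (Suc (r n))) \<longlonglongrightarrow> 0" for K :: real
    using LIMSEQ_subseq_LIMSEQ[OF LIMSEQ_Suc[OF lim_const_over_n[of K]] r] by (simp add: o_def)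
  have "\<mu> \<in> holonomic_measures T lam"
    unfolding holonomic_measures_def
  proof (intro CollectI conjI allI impI \<mu>)
    fix f :: "(nat \<Rightarrow> 's) \<Rightarrow> real" assume f: "continuous_map (shift_top T lam) euclideanreal f"
    note c1 = continuous_map_snd[OF f] and c2 = continuous_map_prepend[OF f]
    obtain B where B: "\<And>z. z \<in> ext_space T \<Longrightarrow> \<bar>f (snd z)\<bar> \<le> B"
      using ext_continuous_bounded[OF lam c1] by blast
    obtain B' where B': "\<And>z. z \<in> ext_space T \<Longrightarrow> \<bar>f (prepend (fst z) (snd z))\<bar> \<le> B'"
      using ext_continuous_bounded[OF lam c2] by blast
    let ?F = "\<lambda>n. (\<Sum>i\<le>r n. f (prepend (fst (z (r n) i)) (snd (z (r n) i)))) / real (Suc (r n)) -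
      (\<Sum>i\<le>r n. f (snd (z (r n) i))) / real (Suc (r n))"
    have l: "?F \<longlonglongrightarrow> (\<integral>z. f (prepend (fst z) (snd z)) \<partial>\<mu>) - (\<integral>z. f (snd z) \<partial>\<mu>)"
      by (intro tendsto_diff lim c1 c2)
    have "\<bar>?F n\<bar> \<le> (B + B') / real (Suc (r n))" for n
    proof -
      have "?F n = (\<Sum>i\<le>r n. f (shift_by i (w (r n))) - f (shift_by (Suc i) (w (r n)))) / real (Suc (r n))"
        unfolding pz by (simp add: z_def sum_subtractf diff_divide_distrib)
      also have "\<dots> = (f (shift_by 0 (w (r n))) - f (shift_by (Suc (r n)) (w (r n)))) / real (Suc (r n))"
        by (subst sum_telescope) simp
      finally have "\<bar>?F n\<bar> = \<bar>f (shift_by 0 (w (r n))) - f (shift_by (Suc (r n)) (w (r n)))\<bar> / real (Suc (r n))"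
        by simp
      moreover have "\<bar>f (shift_by 0 (w (r n)))\<bar> \<le> B'" using B'[OF z[of "r n" 0]] by (simp only: pz)
      moreover have "\<bar>f (shift_by (Suc (r n)) (w (r n)))\<bar> \<le> B"
        using B[OF z[of "r n" "r n"]] by (simp add: z_def)
      ultimately show ?thesis by (simp add: divide_right_mono)
    qed
    then have "?F \<longlonglongrightarrow> 0"
      by (intro Lim_null_comparison[OF _ inv0[of "B + B'"]]) auto
    with l show "(\<integral>z. f (prepend (fst z) (snd z)) \<partial>\<mu>) = (\<integral>z. f (snd z) \<partial>\<mu>)"
      using LIMSEQ_unique by fastforce
  qed
  moreover have "(\<integral>z. A z \<partial>\<mu>) \<le> c"
  proof (rule LIMSEQ_le[OF lim[OF A_continuous]])
    show "(\<lambda>n. c + 2 / real (Suc (r n))) \<longlonglongrightarrow> c"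
      using tendsto_add[OF tendsto_const inv0[of 2], of c] by simp
    \<comment> \<open>One unit of the 2 is the excess of the near-optimal orbit; the other is the
      total error of the chosen pasts, \<open>Suc n\<close> times
      \<open>1 / real (Suc n)\<close>.\<close>
    have "(\<Sum>i\<le>n. A (z n i)) / real (Suc n) \<le> c + 2 / real (Suc n)" for n
    proof -
      have "(\<Sum>i\<le>n. A (z n i)) \<le> (\<Sum>i\<le>n. phi (shift_by i (w n)) + 1 / real (Suc n))"
        unfolding z_def using y(3) by (intro sum_mono)
      also have "\<dots> = S (Suc n) (w n) + 1"
        by (simp add: sum.distrib birkhoff_def lessThan_Suc_atMost)
      also have "\<dots> \<le> real (Suc n) * c + 2" using w(2)[of n] by linarith
      also have "\<dots> = (c + 2 / real (Suc n)) * real (Suc n)"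
        by (simp add: distrib_right mult.commute[of c] del: of_nat_Suc)
      finally show ?thesis by (simp add: pos_divide_le_eq)
    qed
    then show "\<exists>N. \<forall>n\<ge>N. (\<Sum>i\<le>r n. A (z (r n) i)) / real (Suc (r n)) \<le> c + 2 / real (Suc (r n))" by blast
  qed
  ultimately show thesis by (rule that)
qed

text \<open>A Hoelder solution bounds all holonomic integrals below by its constant, and the weak
  limit attains that constant; so the \<open>LEAST\<close> in \<open>min_value\<close> is a genuine
  minimum.\<close>

lemma min_value_subaction:
  obtains u H where "solves (min_value T lam A) u" "holder_le u H" "0 \<le> H"
proof -
  obtain c u H where u: "solves c u" "holder_le u H" "0 \<le> H"
    and c: "\<And>n. \<exists>w\<in>\<Sigma>. S n w \<le> real n * c + 1" by (rule subaction_exists) blast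
  obtain \<mu> where \<mu>: "\<mu> \<in> holonomic_measures T lam" "(\<integral>z. A z \<partial>\<mu>) \<le> c"
    using minimizing_measure_exists[OF c] by blast
  have "min_value T lam A = c"
    unfolding min_value_def
  proof (rule Least_equality)
    show "\<exists>\<mu>\<in>holonomic_measures T lam. c = (\<integral>z. A z \<partial>\<mu>)"
      using \<mu> holonomic_integral_ge[OF u \<mu>(1)] by (intro bexI[of _ \<mu>]) auto
    show "c \<le> a" if "\<exists>\<mu>\<in>holonomic_measures T lam. a = (\<integral>z. A z \<partial>\<mu>)" for a
      using that holonomic_integral_ge[OF u] by auto
  qed
  with u show thesis by (intro that) auto
qed

end

section \<open>Separating sub-actions\<close>

context holder_observable
begin

abbreviation c :: real where "c \<equiv> min_value T lam A"

text \<open>All pasts with the same first letter give the same \<open>prepend y x\<close>, so the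
  inequalities for all of them amount to the single inequality for their infimum.\<close>

lemma subaction_iff_solves:
  assumes "holder_le u H" "0 \<le> H"
  shows "subaction T lam A u \<longleftrightarrow> solves c u"
proof
  assume sub: "subaction T lam A u"
  show "solves c u"
    unfolding solves_def
  proof
    fix w assume w: "w \<in> \<Sigma>"
    have "u (shift_by 1 w) - u w + c \<le> phi w"
    proof (rule phi_ge)
      fix y assume y: "y \<in> past_space T" "y 0 = w 0"
      then have "(y, shift_by (Suc 0) w) \<in> ext_space T" using w by (intro pair_in_ext_space)
      with sub have "u (shift_by (Suc 0) w) - u (prepend y (shift_by (Suc 0) w)) \<le> A (y, shift_by (Suc 0) w) - c"
        by (auto simp: subaction_def)
      then show "u (shift_by 1 w) - u w + c \<le> A (y, shift_by 1 w)"
        by (simp add: prepend_shift_by y(2))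
    qed
    then show "u (shift_by 1 w) \<le> u w + phi w - c" by linarith
  qed
next
  assume s: "solves c u"
  have "u x - u (prepend y x) \<le> A (y, x) - c" if z: "(y, x) \<in> ext_space T" for x y
    using s prepend_in_space[OF z] phi_prepend_le[OF z] unfolding solves_def by force
  then show "subaction T lam A u"
    using holder_continuous[OF assms] by (auto simp: subaction_def)
qed

lemma holder_functions_le:
  assumes "u \<in> holder_functions T lam \<theta>"
  obtains H where "holder_le u H" "0 \<le> H"
proof -
  obtain H where H: "\<And>x x'. x \<in> \<Sigma> \<Longrightarrow> x' \<in> \<Sigma> \<Longrightarrow> \<bar>u x - u x'\<bar> \<le> H * dist_theta x x'"
    using assms by (auto simp: holder_functions_def holder_on_def)
  have "holder_le u \<bar>H\<bar>"
    unfolding holder_le_def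
  proof (intro ballI)
    fix x x' assume "x \<in> \<Sigma>" "x' \<in> \<Sigma>"
    then have "\<bar>u x - u x'\<bar> \<le> H * dist_theta x x'" by (rule H)
    also have "\<dots> \<le> \<bar>H\<bar> * dist_theta x x'" by (intro mult_right_mono) auto
    finally show "\<bar>u x - u x'\<bar> \<le> \<bar>H\<bar> * dist_theta x x'" .
  qed
  then show thesis by (rule that) simp
qed

text \<open>Infima and series leave unspecified values off the subshift, whereas
  \<open>holder_functions\<close> demands extensional functions.\<close>

lemma restrict_in_holder_functions:
  assumes "holder_le u H"
  shows "restrict u \<Sigma> \<in> holder_functions T lam \<theta>" "holder_le (restrict u \<Sigma>) H"
  using assms unfolding holder_functions_def holder_on_def holder_le_def by auto

lemma defect_restrict: "w \<in> \<Sigma> \<Longrightarrow> defect c (restrict u \<Sigma>) w = defect c u w"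
  using shift_by_in_space[of w T 1] by (simp add: defect_def)

lemma solves_restrict: "solves c (restrict u \<Sigma>) \<longleftrightarrow> solves c u"
  by (auto simp: solves_defect defect_restrict)

text \<open>An orbit segment is lifted to a path by attaching near-optimal pasts; as
  \<open>phi\<close> bounds \<open>A\<close> from below, the cost of the path exceeds that of the
  segment by at most the chosen errors.\<close>

lemma nonwandering_potential_subset: "nonwandering_potential c \<subseteq> nonwandering T lam A"
proof
  fix x assume x: "x \<in> nonwandering_potential c"
  then have xS: "x \<in> \<Sigma>" by (simp add: nonwandering_potential_def)
  have "\<exists>k\<ge>1. \<exists>z\<in>paths T lam k x x e. \<bar>\<Sum>i=1..k. A (z i) - c\<bar> < e" if e: "0 < e" for e
  proof -
    obtain k w where k: "k \<ge> 1" "w \<in> \<Sigma>" "shift_dist lam w x < e / 2"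
      "shift_dist lam (shift_by k w) x < e / 2" "\<bar>S k w - real k * c\<bar> < e / 2"
      using x e unfolding nonwandering_potential_def by (force dest: spec[of _ "e / 2"])
    \<comment> \<open>Half of \<open>e\<close> is spread evenly over the \<open>k\<close> steps; the
      other half is the cost bound for the orbit segment.\<close>
    define d where "d = e / (2 * real k)"
    have d: "0 < d" "real k * d = e / 2" using e k(1) by (auto simp: d_def)
    have "\<forall>i. \<exists>y. y \<in> past_space T \<and> y 0 = w i \<and> A (y, shift_by (Suc i) w) \<le> phi (shift_by i w) + d"
    proof
      fix i
      obtain y where "y \<in> past_space T" "y 0 = shift_by i w 0"
        "A (y, shift_by 1 (shift_by i w)) < phi (shift_by i w) + d"
        by (rule phi_approx[OF d(1), of "shift_by i w"])
      then show "\<exists>y. y \<in> past_space T \<and> y 0 = w i \<and> A (y, shift_by (Suc i) w) \<le> phi (shift_by i w) + d"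
        by (intro exI[of _ y]) (auto simp: shift_by_apply)
    qed
    from choice[OF this] obtain y where y: "\<And>i. y i \<in> past_space T" "\<And>i. y i 0 = w i"
      "\<And>i. A (y i, shift_by (Suc i) w) \<le> phi (shift_by i w) + d" by blast
    \<comment> \<open>The cost sum starts at index 1, so \<open>z 0\<close> may carry any admissible
      past. The pair describing the step out of \<open>shift_by j w\<close> has path index
      \<open>Suc j\<close>, because each point of a path is obtained by prepending to the next
      one.\<close>
    obtain s where s: "T $ s $ w 0 = 1" using ex_predecessor by blast
    obtain y0 where y0: "y0 \<in> past_space T" "y0 0 = s" using ex_past by blast
    define z where "z i = (case i of 0 \<Rightarrow> (y0, w) | Suc j \<Rightarrow> (y j, shift_by (Suc j) w))" for i
    have ext: "(y j, shift_by (Suc j) w) \<in> ext_space T" for j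
      using pair_in_ext_space[OF y(1)[of j] shift_by_in_space[OF k(2), of j]] y(2)[of j]
      by (simp add: shift_by_apply)
    have snd_z: "snd (z i) = shift_by i w" for i by (simp add: z_def split: nat.split)
    have zx: "z i \<in> ext_space T" for i
      using ext y0 s k(2) by (auto simp: z_def ext_space_def past_fibre_def split: nat.split)
    have zs: "snd (z i) = prepend (fst (z (Suc i))) (snd (z (Suc i)))" for i
      using prepend_shift_by[of "y i" "shift_by i w"] y(2)[of i] unfolding snd_z
      by (simp add: z_def shift_by_apply)
    have "shift_dist lam (snd (z 0)) x < e" "shift_dist lam (snd (z k)) x < e"
      using k(3,4) e unfolding snd_z by simp_all
    then have "z \<in> paths T lam k x x e"
      unfolding paths_def using zx zs by blast
    moreover have "\<bar>\<Sum>i=1..k. A (z i) - c\<bar> < e"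
    proof -
      have "(\<Sum>i=1..k. A (z i) - c) = (\<Sum>i<k. A (z (Suc i)) - c)"
        by (rule sum.reindex_bij_witness[of _ Suc "\<lambda>i. i - 1"]) auto
      also have "\<dots> = (\<Sum>i<k. A (y i, shift_by (Suc i) w)) - real k * c"
        by (simp add: z_def sum_subtractf)
      finally have eq: "(\<Sum>i=1..k. A (z i) - c) = (\<Sum>i<k. A (y i, shift_by (Suc i) w)) - real k * c" .
      have "(\<Sum>i<k. A (y i, shift_by (Suc i) w)) \<le> (\<Sum>i<k. phi (shift_by i w) + d)"
        using y(3) by (intro sum_mono)
      also have "\<dots> = S k w + e / 2" by (simp add: sum.distrib birkhoff_def d(2))
      finally have up: "(\<Sum>i<k. A (y i, shift_by (Suc i) w)) \<le> S k w + e / 2" .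
      have "phi (shift_by i w) \<le> A (y i, shift_by (Suc i) w)" for i
        using phi_le[OF y(1)[of i] shift_by_in_space[OF k(2), of i]] y(2)[of i] by (simp add: shift_by_apply)
      then have "S k w \<le> (\<Sum>i<k. A (y i, shift_by (Suc i) w))"
        unfolding birkhoff_def by (intro sum_mono)
      with up k(5) show ?thesis unfolding eq by linarith
    qed
    ultimately show ?thesis using k(1) by blast
  qed
  with xS show "x \<in> nonwandering T lam A" by (simp add: nonwandering_def)
qed

text \<open>
  Along an almost closed path of almost zero cost all defects are nonnegative and add up to almost
  zero, so in particular the last one is small; by compactness the end points accumulate at a contact
  point over \<open>x\<close>.
\<close>

lemma nonwandering_subset_contact:
  assumes u: "solves c u" "holder_le u H" "0 \<le> H"
  shows "nonwandering T lam A \<subseteq> snd ` contact_locus T lam A u"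
proof
  fix x assume x: "x \<in> nonwandering T lam A"
  then have xS: "x \<in> \<Sigma>" by (simp add: nonwandering_def)
  define E where "E v = A v - c - u (snd v) + u (prepend (fst v) (snd v))" for v
  have cu: "continuous_map (shift_top T lam) euclideanreal u" using u by (intro holder_continuous)
  have E_cont: "continuous_map (ext_top T lam) euclideanreal E"
    unfolding E_def
    by (intro continuous_map_add continuous_map_diff A_continuous continuous_map_snd[OF cu]
        continuous_map_prepend[OF cu]) simp
  have E_nonneg: "0 \<le> E v" if "v \<in> ext_space T" for v
  proof -
    have v: "(fst v, snd v) \<in> ext_space T" using that by simp
    show ?thesis
      using u(1) prepend_in_space[OF v] phi_prepend_le[OF v] unfolding solves_def E_def by force
  qed
  define \<epsilon> where "\<epsilon> n = 1 / real (Suc n)" for n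
  have eps: "0 < \<epsilon> n" for n by (simp add: \<epsilon>_def)
  have "\<exists>v. v \<in> ext_space T \<and> shift_dist lam (snd v) x < \<epsilon> n \<and> E v \<le> \<epsilon> n + H * \<epsilon> n powr \<theta>" for n
  proof -
    obtain k z where k: "k \<ge> 1" and z: "z \<in> paths T lam k x x (\<epsilon> n)" and s: "\<bar>\<Sum>i=1..k. A (z i) - c\<bar> < \<epsilon> n"
      using x eps[of n] unfolding nonwandering_def by blast
    have ext: "\<And>i. i \<le> k \<Longrightarrow> z i \<in> ext_space T"
      and step: "\<And>i. i < k \<Longrightarrow> snd (z i) = prepend (fst (z (Suc i))) (snd (z (Suc i)))"
      and ends: "shift_dist lam (snd (z 0)) x < \<epsilon> n" "shift_dist lam (snd (z k)) x < \<epsilon> n"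
      using z by (auto simp: paths_def)
    have "shift_dist lam (snd (z k)) (snd (z 0)) \<le> \<epsilon> n"
      using shift_dist_ultra[OF lam, of "snd (z k)" "snd (z 0)" x] ends shift_dist_commute[of lam x "snd (z 0)"]
      by linarith
    then have "dist_theta (snd (z k)) (snd (z 0)) \<le> \<epsilon> n powr \<theta>"
      using theta shift_dist_nonneg[OF lam(1)] by (intro powr_mono2) auto
    then have "H * dist_theta (snd (z k)) (snd (z 0)) \<le> H * \<epsilon> n powr \<theta>" using u(3) by (rule mult_left_mono)
    moreover have "\<bar>u (snd (z k)) - u (snd (z 0))\<bar> \<le> H * dist_theta (snd (z k)) (snd (z 0))"
      using u(2) snd_in_space[OF ext[of k]] snd_in_space[OF ext[of 0]] by (simp add: holder_le_def)
    ultimately have osc: "\<bar>u (snd (z k)) - u (snd (z 0))\<bar> \<le> H * \<epsilon> n powr \<theta>" by linarith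
    \<comment> \<open>The last defect is singled out because its end point is close to
      \<open>x\<close>. All defects being nonnegative, it is at most their sum, where the
      \<open>u\<close>-terms telescope to the oscillation between the two ends.\<close>
    have "E (z k) \<le> (\<Sum>i=1..k. E (z i))"
      using k E_nonneg[OF ext] by (intro member_le_sum) auto
    also have "\<dots> = (\<Sum>i=1..k. A (z i) - c) - (\<Sum>i=1..k. u (snd (z i)) - u (snd (z (i - 1))))"
    proof -
      have "E (z i) = (A (z i) - c) - (u (snd (z i)) - u (snd (z (i - 1))))" if "i \<in> {1..k}" for i
      proof -
        have "i - 1 < k" "Suc (i - 1) = i" using that by auto
        then have "snd (z (i - 1)) = prepend (fst (z i)) (snd (z i))" using step[of "i - 1"] by simp
        then show ?thesis by (simp add: E_def)
      qed
      then show ?thesis by (simp add: sum_subtractf)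
    qed
    also have "(\<Sum>i=1..k. u (snd (z i)) - u (snd (z (i - 1)))) = (\<Sum>i<k. u (snd (z (Suc i))) - u (snd (z i)))"
      by (rule sum.reindex_bij_witness[of _ Suc "\<lambda>i. i - 1"]) auto
    also have "\<dots> = u (snd (z k)) - u (snd (z 0))" by (rule sum_lessThan_telescope)
    finally have "E (z k) \<le> \<epsilon> n + H * \<epsilon> n powr \<theta>" using s osc by linarith
    with ext[of k] ends(2) show ?thesis by blast
  qed
  then obtain v where v: "\<And>n. v n \<in> ext_space T" "\<And>n. shift_dist lam (snd (v n)) x < \<epsilon> n"
    "\<And>n. E (v n) \<le> \<epsilon> n + H * \<epsilon> n powr \<theta>" by metis
  obtain r l where l: "l \<in> ext_space T" "strict_mono r"
    "\<And>n. \<forall>\<^sub>F m in sequentially. agree n (v (r m)) l"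
    by (rule ext_space_subsequence[of v, OF v(1)]) blast
  have e0: "\<epsilon> \<longlonglongrightarrow> 0" unfolding \<epsilon>_def using LIMSEQ_Suc[OF lim_const_over_n[of 1]] by simp
  have e0r: "(\<lambda>m. \<epsilon> (r m)) \<longlonglongrightarrow> 0" using LIMSEQ_subseq_LIMSEQ[OF e0 l(2)] by (simp add: o_def)
  have "snd l j = x j" for j
  proof -
    have "\<forall>\<^sub>F m in sequentially. \<epsilon> (r m) < lam ^ Suc j" using e0r lam by (intro order_tendstoD(2)) auto
    with l(3)[of "Suc j"] have "\<forall>\<^sub>F m in sequentially. snd l j = x j"
    proof eventually_elim
      case (elim m)
      then have "shift_dist lam (snd (v (r m))) x \<le> lam ^ Suc j" using v(2)[of "r m"] by linarith
      then have "snd (v (r m)) j = x j" using shift_dist_le_iff[OF lam] by blast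
      with elim(1) show ?case by (simp add: agree_def)
    qed
    then show ?thesis by simp
  qed
  then have lx: "snd l = x" by auto
  have "E l \<le> 0"
  proof (rule ccontr)
    assume "\<not> E l \<le> 0"
    then have pos: "0 < E l / 2" by simp
    then obtain n where n: "\<And>z. z \<in> ext_space T \<Longrightarrow> agree n l z \<Longrightarrow> \<bar>E l - E z\<bar> < E l / 2"
      using E_cont l(1) unfolding continuous_map_ext_iff[OF lam] by meson
    have "(\<lambda>m. \<epsilon> (r m) + H * \<epsilon> (r m) powr \<theta>) \<longlonglongrightarrow> 0 + H * 0"
    proof (intro tendsto_add e0r tendsto_mult_left)
      show "(\<lambda>m. \<epsilon> (r m) powr \<theta>) \<longlonglongrightarrow> 0"
        using tendsto_powr2[OF e0r tendsto_const[of \<theta>]] eps theta by (simp add: less_imp_le)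
    qed
    then have "\<forall>\<^sub>F m in sequentially. \<epsilon> (r m) + H * \<epsilon> (r m) powr \<theta> < E l / 2"
      using pos by (intro order_tendstoD(2)) auto
    with l(3)[of n] have "\<forall>\<^sub>F m :: nat in sequentially. False"
    proof eventually_elim
      case (elim m)
      then have "agree n l (v (r m))" by (auto simp: agree_def)
      then have "\<bar>E l - E (v (r m))\<bar> < E l / 2" using n v(1) by blast
      with elim(2) v(3)[of "r m"] show False by linarith
    qed
    then show False by simp
  qed
  with E_nonneg[OF l(1)] have "E l = 0" by simp
  then have "l \<in> contact_locus T lam A u"
    using l(1) by (cases l) (auto simp: contact_locus_def E_def)
  with lx show "x \<in> snd ` contact_locus T lam A u" by (intro image_eqI[of _ _ l]) auto
qed

text \<open>As \<open>phi\<close> is at most \<open>A\<close>, contact at \<open>(y, x)\<close>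
  forces defect zero at the preimage \<open>prepend y x\<close> of \<open>x\<close>. The projected
  contact locus then lies in the non-wandering set of the potential, which closes the circle of
  inclusions.\<close>

lemma separatingI:
  assumes u: "solves c u" "holder_le u H" "0 \<le> H"
    and pos: "\<And>w. w \<in> \<Sigma> \<Longrightarrow> shift_by 1 w \<notin> nonwandering_potential c \<Longrightarrow> 0 < defect c u w"
  shows "separating T lam A u"
proof -
  have "snd v \<in> nonwandering T lam A" if "v \<in> contact_locus T lam A u" for v
  proof (rule ccontr)
    assume "snd v \<notin> nonwandering T lam A"
    then have nw: "snd v \<notin> nonwandering_potential c" using nonwandering_potential_subset by blast
    obtain y x where "v = (y, x)" by (cases v)
    then have v: "v = (y, x)" "(y, x) \<in> ext_space T" "u x - u (prepend y x) = A (y, x) - c"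
      using that by (auto simp: contact_locus_def)
    have "0 < defect c u (prepend y x)"
      using prepend_in_space[OF v(2)] nw v(1) by (intro pos) auto
    then show False using phi_prepend_le[OF v(2)] v(3) by (simp add: defect_def)
  qed
  with nonwandering_subset_contact[OF u] show ?thesis
    using u subaction_iff_solves[OF u(2,3)] by (auto simp: separating_def)
qed

lemma locally_separating_subaction:
  obtains u H where "solves c u" "holder_le u H" "0 \<le> H"
    "\<And>x. x \<in> \<Sigma> \<Longrightarrow> x \<notin> nonwandering_potential c \<Longrightarrow>
      \<exists>p d. x \<in> cylinder p \<and> 0 < d \<and> (\<forall>w\<in>\<Sigma>. shift_by 1 w \<in> cylinder p \<longrightarrow> d \<le> defect c u w)"
proof -
  obtain u0 H0 where "solves c u0" "holder_le u0 H0" "0 \<le> H0" by (rule min_value_subaction) blast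
  then interpret potential_with_subaction T lam \<theta> phi_const phi c u0 H0 by unfold_locales
  show thesis by (rule separating_potential) (rule that)
qed

section \<open>Genericity in the Hoelder metric\<close>

lemma holder_dist_upper:
  assumes "u \<in> holder_functions T lam \<theta>" "v \<in> holder_functions T lam \<theta>"
    and "\<And>x. x \<in> \<Sigma> \<Longrightarrow> \<bar>u x - v x\<bar> \<le> B" "holder_le (\<lambda>x. u x - v x) H" "0 \<le> H"
  shows "holder_dist T lam \<theta> u v \<le> B + H"
proof -
  have "(SUP x\<in>\<Sigma>. \<bar>u x - v x\<bar>) \<le> B" using space_nonempty assms(3) by (rule cSUP_least)
  moreover have "Sup (insert 0 {\<bar>(u x - v x) - (u x' - v x')\<bar> / dist_theta x x' | x x'.
      x \<in> \<Sigma> \<and> x' \<in> \<Sigma> \<and> x \<noteq> x'}) \<le> H"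
  proof (rule cSup_least)
    fix s assume "s \<in> insert 0 {\<bar>(u x - v x) - (u x' - v x')\<bar> / dist_theta x x' | x x'.
      x \<in> \<Sigma> \<and> x' \<in> \<Sigma> \<and> x \<noteq> x'}"
    then consider "s = 0" | x x' where "x \<in> \<Sigma>" "x' \<in> \<Sigma>" "x \<noteq> x'"
      "s = \<bar>(u x - v x) - (u x' - v x')\<bar> / dist_theta x x'" by blast
    then show "s \<le> H"
    proof cases
      case 2
      have "0 < dist_theta x x'" using 2(3) lam shift_dist_eq_0[OF lam(1), of x x'] by simp
      moreover have "\<bar>(u x - v x) - (u x' - v x')\<bar> \<le> H * dist_theta x x'"
        using assms(4) 2 by (simp add: holder_le_def)
      ultimately show ?thesis unfolding 2(4) by (simp add: pos_divide_le_eq)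
    qed (use assms(5) in auto)
  qed auto
  ultimately show ?thesis using assms(1,2) by (simp add: holder_dist_def holder_norm_def)
qed

text \<open>Hoelder closeness implies uniform closeness, which is all that the openness argument
  uses.\<close>

lemma holder_dist_lower:
  assumes "u \<in> holder_functions T lam \<theta>" "v \<in> holder_functions T lam \<theta>" "x \<in> \<Sigma>"
  shows "\<bar>u x - v x\<bar> \<le> holder_dist T lam \<theta> u v"
proof -
  have h: "holder_on \<Sigma> (shift_dist lam) \<theta> (\<lambda>x. u x - v x)"
    using assms by (auto simp: holder_functions_def intro: holder_on_diff)
  note bdd = holder_norm_bdd[OF lam theta h]
  have "\<bar>u x - v x\<bar> \<le> (SUP x\<in>\<Sigma>. \<bar>u x - v x\<bar>)" using assms(3) bdd(1) by (rule cSUP_upper)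
  moreover have "0 \<le> Sup (insert 0 {\<bar>(u x - v x) - (u x' - v x')\<bar> / dist_theta x x' | x x'.
      x \<in> \<Sigma> \<and> x' \<in> \<Sigma> \<and> x \<noteq> x'})"
    by (rule cSup_upper[OF _ bdd(2)]) auto
  ultimately show ?thesis using assms(1,2) by (simp add: holder_dist_def holder_norm_def)
qed

text \<open>The gap \<open>d\<close> is uniform over the cylinder, so it survives a small
  perturbation in the supremum norm.\<close>

definition nondegenerate_on :: "'s list \<Rightarrow> ((nat \<Rightarrow> 's) \<Rightarrow> real) \<Rightarrow> bool" where
  "nondegenerate_on p u \<longleftrightarrow>
     (\<exists>d>0. \<forall>w\<in>\<Sigma>. shift_by 1 w \<in> cylinder p \<longrightarrow> d \<le> defect c u w)"

lemma holder_subactions_iff: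
  "u \<in> holder_subactions T lam \<theta> A \<longleftrightarrow> u \<in> holder_functions T lam \<theta> \<and> solves c u"
  using subaction_iff_solves holder_functions_le by (metis (no_types, lifting) holder_subactions_def mem_Collect_eq)

lemma separating_exists_and_generic:
  "(\<exists>u\<in>holder_functions T lam \<theta>. separating T lam A u) \<and>
    generic_in (subtopology (holder_top T lam \<theta>) (holder_subactions T lam \<theta> A))
      {u \<in> holder_subactions T lam \<theta> A. separating T lam A u}"
proof -
  let ?\<H> = "holder_functions T lam \<theta>" and ?\<S> = "holder_subactions T lam \<theta> A"
  let ?d = "holder_dist T lam \<theta>"
  obtain v' H' where v': "solves c v'" "holder_le v' H'" "0 \<le> H'"
    and v'_sep: "\<And>x. x \<in> \<Sigma> \<Longrightarrow> x \<notin> nonwandering_potential c \<Longrightarrow>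
      \<exists>p d. x \<in> cylinder p \<and> 0 < d \<and> (\<forall>w\<in>\<Sigma>. shift_by 1 w \<in> cylinder p \<longrightarrow> d \<le> defect c v' w)"
    by (rule locally_separating_subaction) blast
  define v where "v = restrict v' \<Sigma>"
  have v: "solves c v" "holder_le v H'" "v \<in> ?\<H>"
    using v' restrict_in_holder_functions[OF v'(2)] by (auto simp: v_def solves_restrict)
  have v_sep: "\<exists>p. x \<in> cylinder p \<and> nondegenerate_on p v"
    if x: "x \<in> \<Sigma>" "x \<notin> nonwandering_potential c" for x
  proof -
    obtain p d where p: "x \<in> cylinder p" "0 < d"
      "\<And>w. w \<in> \<Sigma> \<Longrightarrow> shift_by 1 w \<in> cylinder p \<Longrightarrow> d \<le> defect c v' w"
      using v'_sep[OF x] by blast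
    then have "nondegenerate_on p v"
      unfolding nondegenerate_on_def v_def by (intro exI[of _ d]) (auto simp: defect_restrict)
    with p(1) show ?thesis by blast
  qed
  \<comment> \<open>The cylinders on which \<open>v\<close> is nondegenerate cover the complement of
    the non-wandering set; so a sub-action nondegenerate on all of these is separating.\<close>
  have sep: "separating T lam A u"
    if u: "u \<in> ?\<S>" and nd: "\<And>p. nondegenerate_on p v \<Longrightarrow> nondegenerate_on p u" for u
  proof -
    have "u \<in> ?\<H>" and s: "solves c u" using u by (auto simp: holder_subactions_iff)
    obtain H where H: "holder_le u H" "0 \<le> H" using holder_functions_le[OF \<open>u \<in> ?\<H>\<close>] by blast
    show ?thesis
    proof (rule separatingI[OF s H])
      fix w assume w: "w \<in> \<Sigma>" "shift_by 1 w \<notin> nonwandering_potential c"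
      obtain p where "shift_by 1 w \<in> cylinder p" "nondegenerate_on p v"
        using v_sep[OF shift_by_in_space[OF w(1)] w(2)] by blast
      with nd[of p] w(1) show "0 < defect c u w"
        unfolding nondegenerate_on_def by (meson less_le_trans)
    qed
  qed
  have vS: "v \<in> ?\<S>" using v by (simp add: holder_subactions_iff)
  have "separating T lam A v" by (rule sep[OF vS])
  with v(3) have first: "\<exists>u\<in>?\<H>. separating T lam A u" by blast
  have SH: "?\<S> \<subseteq> ?\<H>" by (auto simp: holder_subactions_def)
  interpret M: Metric_space ?\<H> ?d by (rule Metric_space_holder[OF lam theta space_nonempty])
  interpret N: Submetric ?\<H> ?d ?\<S> by unfold_locales (rule SH)
  have top: "subtopology (holder_top T lam \<theta>) ?\<S> = N.sub.mtopology"
    by (simp add: holder_top_def N.mtopology_submetric)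
  \<comment> \<open>Words on which \<open>v\<close> is degenerate impose no condition: a cylinder
    that meets the non-wandering set has contact points above it for every Hoelder sub-action, and
    the condition there would define the empty set.\<close>
  define U where "U n = (if nondegenerate_on (from_nat n) v
      then {u \<in> ?\<S>. nondegenerate_on (from_nat n) u} else ?\<S>)" for n
  have U_sub: "U n \<subseteq> ?\<S>" for n by (auto simp: U_def)
  have U_open: "openin N.sub.mtopology (U n)" for n
    unfolding N.sub.openin_mtopology
  proof (intro conjI U_sub allI impI)
    fix u assume u: "u \<in> U n"
    show "\<exists>r>0. N.sub.mball u r \<subseteq> U n"
    proof (cases "nondegenerate_on (from_nat n) v")
      case True
      then have uS: "u \<in> ?\<S>" and "nondegenerate_on (from_nat n) u" using u by (auto simp: U_def)
      then obtain d where d: "0 < d" "\<And>w. w \<in> \<Sigma> \<Longrightarrow> shift_by 1 w \<in> cylinder (from_nat n) \<Longrightarrow> d \<le> defect c u w"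
        unfolding nondegenerate_on_def by blast
      have "u' \<in> U n" if u': "u' \<in> N.sub.mball u (d / 3)" for u'
      proof -
        have u'S: "u' \<in> ?\<S>" and dist: "?d u u' < d / 3" using u' by (auto simp: N.sub.in_mball)
        \<comment> \<open>The defect evaluates \<open>u\<close> at two points, so a perturbation
          below \<open>d / 3\<close> changes it by less than \<open>2 * d / 3\<close> and leaves a
          gap of \<open>d / 3\<close>.\<close>
        have close: "\<bar>u x - u' x\<bar> < d / 3" if "x \<in> \<Sigma>" for x
          using holder_dist_lower[of u u' x] uS u'S SH that dist by force
        have "d / 3 \<le> defect c u' w" if w: "w \<in> \<Sigma>" "shift_by 1 w \<in> cylinder (from_nat n)" for w
          using d(2)[OF w] close[OF w(1)] close[OF shift_by_in_space[OF w(1), of 1]]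
          unfolding defect_def by linarith
        then have "nondegenerate_on (from_nat n) u'"
          unfolding nondegenerate_on_def using d(1) by (intro exI[of _ "d / 3"]) auto
        with u'S True show ?thesis by (simp add: U_def)
      qed
      with d(1) show ?thesis by (intro exI[of _ "d / 3"]) auto
    next
      case False
      then show ?thesis by (auto simp: U_def intro: exI[of _ 1])
    qed
  qed
  have U_dense: "N.sub.mtopology closure_of (U n) = ?\<S>" for n
  proof -
    have "\<exists>u'\<in>U n. u' \<in> N.sub.mball u r" if u: "u \<in> ?\<S>" and r: "0 < r" for u r
    proof -
      have uH: "u \<in> ?\<H>" and su: "solves c u" using u by (auto simp: holder_subactions_iff)
      obtain H where H: "holder_le u H" "0 \<le> H" using holder_functions_le[OF uH] by blast
      obtain B where B: "\<And>x. x \<in> \<Sigma> \<Longrightarrow> \<bar>u x\<bar> \<le> B" using holder_le_bounded[OF H] by blast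
      obtain B' where B': "\<And>x. x \<in> \<Sigma> \<Longrightarrow> \<bar>v x\<bar> \<le> B'" using holder_le_bounded[OF v(2) v'(3)] by blast
      obtain x0 where x0: "x0 \<in> \<Sigma>" using space_nonempty by blast
      define K where "K = B + B' + H + H'"
      have K: "0 \<le> K" using B[OF x0] B'[OF x0] H(2) v'(3) by (simp add: K_def)
      \<comment> \<open>\<open>K\<close> bounds the Hoelder norm of \<open>u - v\<close>, so moving
        a fraction \<open>t\<close> of the way from \<open>u\<close> to \<open>v\<close> costs at
        most \<open>t * K < r\<close>. The minimum with 1 keeps the combination convex, and
        \<open>K + 1\<close> avoids division by zero.\<close>
      define t where "t = min 1 (r / (2 * (K + 1)))"
      have t: "0 < t" "t \<le> 1" using r K by (auto simp: t_def)
      have "t * K \<le> r / (2 * (K + 1)) * (K + 1)" using K r t by (intro mult_mono) (auto simp: t_def)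
      also have "\<dots> = r / 2" using K by (simp add: field_simps)
      finally have tK: "t * K < r" using r by linarith
      define u1 where "u1 x = (1 - t) * u x + t * v x" for x
      define u' where "u' = restrict u1 \<Sigma>"
      \<comment> \<open>The weights sum to 1, so the terms with \<open>phi\<close> and
        \<open>c\<close> are reproduced and the defect is affine. Dropping the nonnegative share of
        \<open>u\<close> leaves \<open>t\<close> times the defect of \<open>v\<close>, hence a gap
        wherever \<open>v\<close> has one.\<close>
      have def_u1: "defect c u1 w = (1 - t) * defect c u w + t * defect c v w" for w
        by (simp add: defect_def u1_def algebra_simps)
      have lip: "\<bar>u x - u x'\<bar> \<le> H * dist_theta x x'" "\<bar>v x - v x'\<bar> \<le> H' * dist_theta x x'"
        if "x \<in> \<Sigma>" "x' \<in> \<Sigma>" for x x'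
        using H(1) v(2) that by (simp_all add: holder_le_def)
      have hd: "holder_le (\<lambda>x. u x - u' x) (t * (H + H'))"
        unfolding holder_le_def
      proof (intro ballI)
        fix x x' assume x: "x \<in> \<Sigma>" "x' \<in> \<Sigma>"
        have "(u x - u' x) - (u x' - u' x') = t * ((u x - u x') - (v x - v x'))"
          using x by (simp add: u'_def u1_def algebra_simps)
        then have "\<bar>(u x - u' x) - (u x' - u' x')\<bar> = t * \<bar>(u x - u x') - (v x - v x')\<bar>"
          using t by (simp add: abs_mult)
        also have "\<dots> \<le> t * (H * dist_theta x x' + H' * dist_theta x x')"
          using lip[OF x] t by (intro mult_left_mono) linarith+
        finally show "\<bar>(u x - u' x) - (u x' - u' x')\<bar> \<le> t * (H + H') * dist_theta x x'"
          by (simp add: algebra_simps)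
      qed
      have u'H: "u' \<in> ?\<H>"
      proof -
        have "holder_on \<Sigma> (shift_dist lam) \<theta> (\<lambda>x. u x - u' x)"
          using hd unfolding holder_le_def holder_on_def by blast
        from holder_on_diff[OF _ this, of u] have "holder_on \<Sigma> (shift_dist lam) \<theta> u'"
          using uH by (simp add: holder_functions_def)
        then show ?thesis by (simp add: holder_functions_def u'_def)
      qed
      have pos: "0 \<le> defect c u w" "0 \<le> defect c v w" if "w \<in> \<Sigma>" for w
        using su v(1) that by (simp_all add: solves_defect)
      have def_u': "t * defect c v w \<le> defect c u' w" if "w \<in> \<Sigma>" for w
        using pos[OF that] t that by (simp add: u'_def defect_restrict def_u1)
      have "0 \<le> defect c u' w" if "w \<in> \<Sigma>" for w
        using def_u'[OF that] mult_nonneg_nonneg[OF less_imp_le[OF t(1)] pos(2)[OF that]] by linarith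
      then have u'S: "u' \<in> ?\<S>" using u'H by (simp add: holder_subactions_iff solves_defect)
      have "nondegenerate_on p u'" if p: "nondegenerate_on p v" for p
      proof -
        obtain d where d: "0 < d" "\<And>w. w \<in> \<Sigma> \<Longrightarrow> shift_by 1 w \<in> cylinder p \<Longrightarrow> d \<le> defect c v w"
          using p unfolding nondegenerate_on_def by blast
        have "t * d \<le> defect c u' w" if w: "w \<in> \<Sigma>" "shift_by 1 w \<in> cylinder p" for w
          using mult_left_mono[OF d(2)[OF w], of t] def_u'[OF w(1)] t(1) by linarith
        moreover have "0 < t * d" using t(1) d(1) by simp
        ultimately show ?thesis unfolding nondegenerate_on_def by blast
      qed
      then have u'U: "u' \<in> U n" using u'S by (simp add: U_def)
      have "?d u u' \<le> t * (B + B') + t * (H + H')"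
      proof (rule holder_dist_upper[OF uH u'H _ hd])
        fix x assume x: "x \<in> \<Sigma>"
        have "u x - u' x = t * (u x - v x)" using x by (simp add: u'_def u1_def algebra_simps)
        then have "\<bar>u x - u' x\<bar> = t * \<bar>u x - v x\<bar>" using t by (simp add: abs_mult)
        also have "\<dots> \<le> t * (B + B')"
          using B[OF x] B'[OF x] t by (intro mult_left_mono) linarith+
        finally show "\<bar>u x - u' x\<bar> \<le> t * (B + B')" .
      qed (use t H(2) v'(3) in auto)
      also have "\<dots> = t * K" by (simp add: K_def algebra_simps)
      finally have "?d u u' < r" using tK by simp
      with u u'S u'U show ?thesis by (intro bexI[of _ u']) (auto simp: N.sub.in_mball)
    qed
    then show ?thesis unfolding N.sub.metric_closure_of by blast
  qed
  have "(\<Inter>n. U n) \<subseteq> {u \<in> ?\<S>. separating T lam A u}"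
  proof
    fix u assume u: "u \<in> (\<Inter>n. U n)"
    then have uS: "u \<in> ?\<S>" using U_sub by blast
    have "nondegenerate_on p u" if "nondegenerate_on p v" for p
    proof -
      have "u \<in> U (to_nat p)" using u by blast
      with that show ?thesis by (simp add: U_def)
    qed
    with uS sep show "u \<in> {u \<in> ?\<S>. separating T lam A u}" by blast
  qed
  with U_open U_dense have "generic_in (subtopology (holder_top T lam \<theta>) ?\<S>) {u \<in> ?\<S>. separating T lam A u}"
    unfolding top generic_in_def by (intro exI[of _ U]) auto
  with first show ?thesis by blast
qed

end

theorem theorem10:
  fixes T :: "nat ^ 's ^ 's::finite" and lam \<theta> :: real and A :: "'s bisequence \<Rightarrow> real"
  assumes "transition_matrix T" and "irreducible_matrix T"
    and "0 < lam" and "lam < 1" and "0 < \<theta>" and "\<theta> \<le> 1"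
    and "holder_on (ext_space T) (ext_dist lam) \<theta> A"
  shows "(\<exists>u\<in>holder_functions T lam \<theta>. separating T lam A u) \<and>
    generic_in (subtopology (holder_top T lam \<theta>) (holder_subactions T lam \<theta> A))
      {u \<in> holder_subactions T lam \<theta> A. separating T lam A u}"
proof -
  interpret holder_observable T lam \<theta> A
    using assms by unfold_locales
  show ?thesis by (rule separating_exists_and_generic)
qed

end
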